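(* Let $V\in C^2(\mathbb{R})$ satisfy $V(0)=0$ and $xV'(x)>0$ for all $x\neq 0$. Assume that all solutions of $\ddot x+V'(x)=0$ are $2\pi$-periodic and that $V''$ is bounded on $\mathbb{R}$. Let $p\in L^1(\mathbb{T})$ and assume that $\Phi_p$ has a non-degenerate zero $(\theta_*,r_* )\in\mathcal C$ with $r_*>0$. Then the equation $\ddot x+V'(x)=\epsilon p(t)$ has a $2\pi$-periodic solution for small $\epsilon$; that is, there exists $\epsilon_0>0$ such that for every $\epsilon$ with $|\epsilon|<\epsilon_0$ the equation has a $2\pi$-periodic solution.
   Context: $p\in L^1(\mathbb{T})$ means that $p:\mathbb{R}\to\mathbb{R}$ is $2\pi$-periodic and locally integrable; the forced equation is understood in the Carathéodory sense. $\mathcal C=(\mathbb{R}/2\pi\mathbb{Z})\times[0,\infty)$ is the cylinder with coordinates $(\theta,r)$. For $r\ge 0$, $\varphi(t,r)$ is the solution of $\ddot x+V'(x)=0$ with $x(0)=r$, $\dot x(0)=0$, and $\psi(t,r)$ is the complex-valued solution of $\ddot y+V''(\varphi(t,r))y=0$ with $y(0)=1$, $\dot y(0)=i$. The function $\Phi_p:\mathcal C\to\mathbb{C}$ is $$\Phi_p(\theta,r)=\frac1{2\pi}\int_0^{2\pi}p(t-\theta)\,\psi(t,r)\,dt .$$ Non-degeneracy is understood in the topological sense: a zero $(\theta_*,r_* )$ with $r_*>0$ is non-degenerate if there is a small open neighbourhood $\mathcal U$ of $(\theta_*,r_* )$ such that $\Phi_p(\theta,r)\neq0$ for every $(\theta,r)\in\overline{\mathcal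 U}\setminus\{(\theta_*,r_* )\}$ and the Brouwer degree $\deg(\Phi_p,\mathcal U,0)$ is nonzero. Here $\mathcal U$ is regarded as a bounded open subset of $\mathbb{R}^2$ through the coordinates $(\theta,r)$, and $\mathbb{C}$ is identified with $\mathbb{R}^2$. *)

theory Defs
  imports "HOL-Analysis.Analysis"
begin

section \<open>Second-order differential equations\<close>

definition solves_ode2 ::
    "(real \<Rightarrow> 'a \<Rightarrow> 'a) \<Rightarrow> 'a \<Rightarrow> 'a \<Rightarrow> (real \<Rightarrow> 'a::real_normed_vector) \<Rightarrow> bool" where
  "solves_ode2 f a b x \<longleftrightarrow>
     x 0 = a \<and>
     (\<exists>v. v 0 = b \<and>
          (\<forall>t. (x has_vector_derivative v t) (at t) \<and>
               (v has_vector_derivative f t (x t)) (at t)))"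

definition absolutely_continuous_on_interval :: "real \<Rightarrow> real \<Rightarrow> (real \<Rightarrow> real) \<Rightarrow> bool" where
  "absolutely_continuous_on_interval a b f \<longleftrightarrow>
     (\<forall>e>0. \<exists>d>0. \<forall>(n::nat) u v.
        (\<forall>i<n. a \<le> u i \<and> u i \<le> v i \<and> v i \<le> b) \<and>
        disjoint_family_on (\<lambda>i. {u i<..<v i}) {..<n} \<and>
        (\<Sum>i<n. v i - u i) < d
        \<longrightarrow> (\<Sum>i<n. \<bar>f (v i) - f (u i)\<bar>) < e)"

definition caratheodory_solution2 :: "(real \<Rightarrow> real \<Rightarrow> real) \<Rightarrow> (real \<Rightarrow> real) \<Rightarrow> bool" where
  "caratheodory_solution2 f x \<longleftrightarrow>
     (\<exists>v. (\<forall>t. (x has_real_derivative v t) (at t)) \<and>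
          (\<forall>a b. absolutely_continuous_on_interval a b v) \<and>
          (AE t in lebesgue. (v has_real_derivative f t (x t)) (at t)))"

definition periodic_2pi :: "(real \<Rightarrow> 'a) \<Rightarrow> bool" where
  "periodic_2pi x \<longleftrightarrow> (\<forall>t. x (t + 2 * pi) = x t)"

definition L1_torus :: "(real \<Rightarrow> real) \<Rightarrow> bool" where
  "L1_torus p \<longleftrightarrow> periodic_2pi p \<and> (\<forall>a b. p absolutely_integrable_on {a..b})"

section \<open>The function \<open>\<Phi>\<close>\<close>

text \<open>The arguments \<open>V'\<close> and \<open>V''\<close> stand for the first two derivatives of the potential. The
  descriptions below are well defined whenever \<open>V''\<close> is continuous and bounded, since then both
  initial value problems have exactly one solution on the whole line.\<close>

definition free_solution :: "(real \<Rightarrow> real) \<Rightarrow> real \<Rightarrow> real \<Rightarrow> real" where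
  "free_solution V' t r = (THE x. solves_ode2 (\<lambda>_ y. - V' y) r 0 x) t"

definition variational_solution ::
    "(real \<Rightarrow> real) \<Rightarrow> (real \<Rightarrow> real) \<Rightarrow> real \<Rightarrow> real \<Rightarrow> complex" where
  "variational_solution V' V'' t r =
     (THE y. solves_ode2 (\<lambda>s z. - (of_real (V'' (free_solution V' s r)) * z)) 1 \<i> y) t"

text \<open>Functions on the cylinder are represented by functions of \<open>(\<theta>, r)\<close>, \<open>r \<ge> 0\<close>, that are
  \<open>2\<pi>\<close>-periodic in the real variable \<open>\<theta>\<close>.\<close>

definition Phi ::
    "(real \<Rightarrow> real) \<Rightarrow> (real \<Rightarrow> real) \<Rightarrow> (real \<Rightarrow> real) \<Rightarrow> real \<Rightarrow> real \<Rightarrow> complex" where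
  "Phi V' V'' p \<theta> r =
     1 / (2 * of_real pi) *
       (LINT t:{0..2*pi}|lebesgue. of_real (p (t - \<theta>)) * variational_solution V' V'' t r)"

section \<open>Brouwer degree\<close>

text \<open>The degree \<open>deg(f, U, y)\<close> of a continuous map on the closure of a bounded open set, with
  \<open>y \<notin> f(\<partial>U)\<close>, is the common value of \<open>\<Sum> sgn (det Dg(x))\<close> over \<open>x \<in> U \<inter> g\<^sup>-\<^sup>1(y)\<close> for all maps
  \<open>g\<close>, of class \<open>C\<^sup>1\<close> in \<open>U\<close> and continuous up to the boundary, that have \<open>y\<close> as a regular value
  and whose uniform distance from \<open>f\<close> is smaller than the distance from \<open>y\<close> to \<open>f(\<partial>U)\<close>. These
  sums are finite because \<open>g\<close> does not take the value \<open>y\<close> on \<open>\<partial>U\<close>.\<close>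

definition regular_approximation ::
    "(real^'n \<Rightarrow> real^'n) \<Rightarrow> (real^'n) set \<Rightarrow> real^'n \<Rightarrow>
     (real^'n \<Rightarrow> real^'n) \<Rightarrow> (real^'n \<Rightarrow> real^'n^'n) \<Rightarrow> bool" where
  "regular_approximation f U y g Dg \<longleftrightarrow>
     continuous_on (closure U) g \<and>
     (\<forall>x\<in>U. (g has_derivative (\<lambda>h. Dg x *v h)) (at x)) \<and>
     continuous_on U Dg \<and>
     (\<forall>x\<in>closure U. dist (g x) (f x) < infdist y (f ` frontier U)) \<and>
     (\<forall>x\<in>U. g x = y \<longrightarrow> det (Dg x) \<noteq> 0)"

text \<open>It is a theorem that exactly one integer \<open>d\<close> qualifies below as soon as the conditions on
  \<open>f\<close>, \<open>U\<close> and \<open>y\<close> hold; the degree is set to \<open>0\<close> where it is not defined.\<close>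

definition brouwer_degree ::
    "(real^'n \<Rightarrow> real^'n) \<Rightarrow> (real^'n) set \<Rightarrow> real^'n \<Rightarrow> int" where
  "brouwer_degree f U y =
     (let is_deg = (\<lambda>d::int. \<forall>g Dg. regular_approximation f U y g Dg \<longrightarrow>
                      of_int d = (\<Sum>x\<in>{x\<in>U. g x = y}. sgn (det (Dg x))))
      in if open U \<and> bounded U \<and> continuous_on (closure U) f \<and> y \<notin> f ` frontier U \<and>
            (\<exists>!d. is_deg d)
         then (THE d. is_deg d) else 0)"

definition plane_map :: "(real \<Rightarrow> real \<Rightarrow> complex) \<Rightarrow> real^2 \<Rightarrow> real^2" where
  "plane_map F z = vector [Re (F (z$1) (z$2)), Im (F (z$1) (z$2))]"

text \<open>The neighbourhood \<open>U\<close> is small enough to lie over less than a full turn of the cylinder, so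
  that the coordinates \<open>(\<theta>, r)\<close> identify it with an open subset of the plane.\<close>

definition nondegenerate_zero :: "(real \<Rightarrow> real \<Rightarrow> complex) \<Rightarrow> real \<Rightarrow> real \<Rightarrow> bool" where
  "nondegenerate_zero F \<theta>0 r0 \<longleftrightarrow>
     F \<theta>0 r0 = 0 \<and> r0 > 0 \<and>
     (\<exists>U::(real^2) set.
        open U \<and> bounded U \<and> vector [\<theta>0, r0] \<in> U \<and>
        U \<subseteq> {z. \<bar>z$1 - \<theta>0\<bar> < pi \<and> z$2 > 0} \<and>
        (\<forall>z \<in> closure U - {vector [\<theta>0, r0]}. F (z$1) (z$2) \<noteq> 0) \<and>
        brouwer_degree (plane_map F) U 0 \<noteq> 0)"

end

theory Submission
  imports Defs
begin

text \<open>Starting the forced equation at time \<open>-\<theta>\<close> from \<open>(r, 0)\<close> amounts to solving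
  \<open>y'' + V'(y) = \<epsilon> p(t - \<theta>)\<close>, \<open>y(0) = r\<close>, \<open>y'(0) = 0\<close>. Let \<open>d = y - \<phi>(\<cdot>, r)\<close>. Since \<open>\<psi>\<close> solves the
  variational equation, Lagrange's identity gives for \<open>W = d' \<psi> - d \<psi>'\<close>
  that \<open>W(2\<pi>) = 2\<pi> \<epsilon> \<Phi>(\<theta>, r) + o(\<epsilon>)\<close>, uniformly on compact sets. As the Wronskian of \<open>Re \<psi>\<close> and
  \<open>Im \<psi>\<close> is \<open>1\<close> and \<open>\<phi>\<close> is \<open>2\<pi>\<close>-periodic, \<open>y\<close> is \<open>2\<pi>\<close>-periodic as soon as \<open>W(2\<pi>) = 0\<close>. Now
  \<open>W(2\<pi>) / (2\<pi> \<epsilon>)\<close> is continuous in \<open>(\<theta>, r)\<close> and uniformly close to \<open>\<Phi>\<close>, so it vanishes somewhere,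
  because the degree of \<open>\<Phi>\<close> is not zero. As \<open>p\<close> is merely integrable, the forced equation is
  treated through the indefinite integral of \<open>p\<close>, as a system with continuous right-hand side.\<close>

section \<open>Lipschitz differential equations\<close>

lemma antiderivative_exists:
  fixes h :: "real \<Rightarrow> 'a::euclidean_space"
  assumes "continuous_on UNIV h"
  shows "\<exists>A. A 0 = 0 \<and> (\<forall>t. (A has_vector_derivative h t) (at t))"
proof (rule exI[of _ "\<lambda>u::real. LBINT y=0..ereal u. h y"], intro conjI allI)
  show "(LBINT y=0..ereal 0. h y) = 0" by (simp add: zero_ereal_def)
  fix t :: real
  have "((\<lambda>u. LBINT y=0..u. h y) has_vector_derivative h t) (at t within {-(\<bar>t\<bar>+1)..\<bar>t\<bar>+1})"
  proof -
    have "((\<lambda>u. LBINT y=ereal 0..u. h y) has_vector_derivative h t) (at t within {-(\<bar>t\<bar>+1)..\<bar>t\<bar>+1})"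
      by (rule interval_integral_FTC2) (use assms in \<open>auto intro: continuous_on_subset\<close>)
    then show ?thesis by (simp add: zero_ereal_def)
  qed
  moreover have "at t within {-(\<bar>t\<bar>+1)..\<bar>t\<bar>+1} = at t"
    by (rule at_within_interior) auto
  ultimately show "((\<lambda>u. LBINT y=0..u. h y) has_vector_derivative h t) (at t)"
    by simp
qed

lemma exp_growth_of_derivative_nonneg:
  fixes A :: "real \<Rightarrow> 'a::real_normed_vector"
  assumes "A 0 = 0" and "\<And>t. (A has_vector_derivative h t) (at t)"
    and "\<And>t. norm (h t) \<le> c * exp (m * \<bar>t\<bar>)" and "m > 0" and "t \<ge> 0"
  shows "norm (A t) \<le> c / m * exp (m * \<bar>t\<bar>)"
proof -
  have c: "c \<ge> 0"
    using order_trans[OF norm_ge_zero assms(3)[of 0]] by simp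
  show ?thesis
  proof (cases "t = 0")
    case True
    then show ?thesis using assms c by simp
  next
    case False
    have "norm (A t - A 0) \<le> c / m * exp (m * t) - c / m * exp (m * 0)"
    proof (rule differentiable_bound_general[where f' = h and \<phi>' = "\<lambda>s. c * exp (m * s)"])
      show "0 < t" using False assms by simp
      show "continuous_on {0..t} A"
        using assms(2) by (meson continuous_at_imp_continuous_on has_vector_derivative_continuous)
      show "((\<lambda>x. c / m * exp (m * x)) has_vector_derivative c * exp (m * x)) (at x)" for x
        using \<open>m > 0\<close>
        by (auto intro!: derivative_eq_intros simp: has_real_derivative_iff_has_vector_derivative[symmetric])
      show "norm (h x) \<le> c * exp (m * x)" if "0 < x" for x
        using assms(3)[of x] that by simp
    qed (use \<open>m > 0\<close> assms(2) in \<open>auto intro!: continuous_intros\<close>)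
    also have "\<dots> \<le> c / m * exp (m * \<bar>t\<bar>)"
      using assms c by simp
    finally show ?thesis using assms by simp
  qed
qed

lemma has_vector_derivative_reflect:
  assumes "(A has_vector_derivative h) (at (- t))"
  shows "((\<lambda>s. A (- s)) has_vector_derivative - h) (at t)"
proof -
  have "(A \<circ> uminus has_vector_derivative (- 1) *\<^sub>R h) (at t)"
    by (rule vector_diff_chain_at) (auto intro!: derivative_eq_intros assms)
  then show ?thesis by (simp add: o_def)
qed

lemma has_vector_derivative_shift:
  assumes "(A has_vector_derivative h) (at (t + c))"
  shows "((\<lambda>s. A (s + c)) has_vector_derivative h) (at t)"
proof -
  have "(A \<circ> (\<lambda>s. s + c) has_vector_derivative 1 *\<^sub>R h) (at t)"
    by (rule vector_diff_chain_at) (auto intro!: derivative_eq_intros assms)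
  then show ?thesis by (simp add: o_def)
qed

lemma exp_growth_of_derivative:
  fixes A :: "real \<Rightarrow> 'a::real_normed_vector"
  assumes "A 0 = 0" and "\<And>t. (A has_vector_derivative h t) (at t)"
    and "\<And>t. norm (h t) \<le> c * exp (m * \<bar>t\<bar>)" and "m > 0"
  shows "norm (A t) \<le> c / m * exp (m * \<bar>t\<bar>)"
proof (cases "t \<ge> 0")
  case True
  then show ?thesis using exp_growth_of_derivative_nonneg assms by blast
next
  case False
  have "norm (A (- (- t))) \<le> c / m * exp (m * \<bar>- t\<bar>)"
    by (rule exp_growth_of_derivative_nonneg[where h = "\<lambda>s. - h (- s)"])
      (use assms(3)[of "- s" for s] False in
        \<open>auto simp: assms intro!: has_vector_derivative_reflect\<close>)
  then show ?thesis by simp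
qed

text \<open>Picard iteration is a contraction for the norm weighted by \<open>exp (- 2 N \<bar>t\<bar>)\<close>; the
  substitution \<open>z = exp (2 N \<bar>t\<bar>) g\<close> turns this norm into the supremum norm.\<close>

lemma ode_solution_exists:
  fixes f :: "real \<Rightarrow> 'a::euclidean_space \<Rightarrow> 'a"
  assumes cont: "continuous_on UNIV (\<lambda>(t, x). f t x)"
    and lip: "\<And>t a b. norm (f t a - f t b) \<le> L * norm (a - b)"
    and growth: "\<And>t. norm (f t 0) \<le> C * exp (K * \<bar>t\<bar>)"
  shows "\<exists>z. z 0 = z0 \<and> (\<forall>t. (z has_vector_derivative f t (z t)) (at t))"
proof -
  define N where "N = max 1 (max L K)"
  have N: "N \<ge> 1" "N \<ge> L" "N \<ge> K" by (auto simp: N_def)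
  have C: "C \<ge> 0"
    using order_trans[OF norm_ge_zero growth[of 0]] by simp
  define w where "w t = exp (2 * N * \<bar>t\<bar>)" for t
  have w: "w t \<ge> 1" "w t > 0" for t using N by (auto simp: w_def)
  have contw: "continuous_on UNIV w"
    unfolding w_def by (intro continuous_intros)
  define h where "h g t = f t (w t *\<^sub>R apply_bcontfun g t)" for g t
  have conth: "continuous_on UNIV (h g)" for g
  proof -
    have "continuous_on UNIV (\<lambda>t. (t, w t *\<^sub>R apply_bcontfun g t))"
      by (intro continuous_intros contw continuous_on_apply_bcontfun)
    from continuous_on_compose2[OF cont this] show ?thesis
      by (simp add: h_def[abs_def])
  qed
  obtain A where A0: "\<And>g. A g 0 = 0"
    and A: "\<And>g t. (A g has_vector_derivative h g t) (at t)"
    using antiderivative_exists[OF conth] by metis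
  have nh: "norm (h g t) \<le> (C + N * norm g) * exp (2 * N * \<bar>t\<bar>)" for g t
  proof -
    have "norm (h g t) \<le> norm (f t 0) + norm (h g t - f t 0)"
      using norm_triangle_sub by blast
    also have "norm (h g t - f t 0) \<le> L * norm (w t *\<^sub>R apply_bcontfun g t)"
      using lip[of t "w t *\<^sub>R apply_bcontfun g t" 0] by (simp add: h_def)
    also have "L * norm (w t *\<^sub>R apply_bcontfun g t) \<le> N * (w t * norm g)"
      using N w[of t] norm_bounded[of g t] by (intro mult_mono) (auto intro!: mult_left_mono)
    also have "norm (f t 0) \<le> C * w t"
    proof -
      have "K * \<bar>t\<bar> \<le> 2 * N * \<bar>t\<bar>" using N by (intro mult_right_mono) auto
      then have "C * exp (K * \<bar>t\<bar>) \<le> C * w t"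
        unfolding w_def using C by (intro mult_left_mono) auto
      with growth[of t] show ?thesis by linarith
    qed
    finally show ?thesis by (simp add: w_def algebra_simps)
  qed
  have contA: "continuous_on UNIV (A g)" for g
    using A by (meson continuous_at_imp_continuous_on has_vector_derivative_continuous)
  define T0 where "T0 g t = inverse (w t) *\<^sub>R (z0 + A g t)" for g t
  have "T0 g \<in> bcontfun" for g
  proof (rule bcontfun_normI)
    have "w t \<noteq> 0" for t using w[of t] by auto
    then show "continuous_on UNIV (T0 g)"
      unfolding T0_def by (intro continuous_intros contA contw) auto
    show "norm (T0 g t) \<le> norm z0 + (C + N * norm g) / (2 * N)" for t
    proof -
      have "norm (A g t) \<le> (C + N * norm g) / (2 * N) * w t"
        unfolding w_def
        by (rule exp_growth_of_derivative[where h = "h g"]) (use A0 A nh N in auto)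
      moreover have "norm z0 \<le> norm z0 * w t"
        using w[of t] by (simp add: mult_le_cancel_left1)
      ultimately have "norm (z0 + A g t) \<le> (norm z0 + (C + N * norm g) / (2 * N)) * w t"
        using norm_triangle_ineq[of z0 "A g t"] by (simp add: distrib_right)
      then have "inverse (w t) * norm (z0 + A g t)
          \<le> inverse (w t) * ((norm z0 + (C + N * norm g) / (2 * N)) * w t)"
        using w[of t] by (intro mult_left_mono) auto
      also have "\<dots> = norm z0 + (C + N * norm g) / (2 * N)"
        using less_imp_neq[OF w(2)[of t]] by (subst mult.commute) (simp only: mult.assoc right_inverse simp_thms mult_1_right)
      finally show ?thesis
        unfolding T0_def norm_scaleR abs_of_pos[OF positive_imp_inverse_positive[OF w(2)[of t]]] .
    qed
  qed
  then have T: "apply_bcontfun (Bcontfun (T0 g)) = T0 g" for g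
    by (simp add: Bcontfun_inverse)
  define T where "T g = Bcontfun (T0 g)" for g
  note T = T[folded T_def]
  have "dist (T g1) (T g2) \<le> 1/2 * dist g1 g2" for g1 g2
  proof (rule dist_bound)
    fix t
    have "norm ((\<lambda>t. A g1 t - A g2 t) t) \<le> (N * dist g1 g2) / (2 * N) * w t"
      unfolding w_def
    proof (rule exp_growth_of_derivative)
      show "((\<lambda>t. A g1 t - A g2 t) has_vector_derivative (h g1 s - h g2 s)) (at s)" for s
        by (intro derivative_intros A)
      show "norm (h g1 s - h g2 s) \<le> N * dist g1 g2 * exp (2 * N * \<bar>s\<bar>)" for s
      proof -
        have "norm (h g1 s - h g2 s) \<le> L * norm (w s *\<^sub>R apply_bcontfun g1 s - w s *\<^sub>R apply_bcontfun g2 s)"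
          unfolding h_def by (rule lip)
        also have "\<dots> \<le> N * (w s * dist g1 g2)"
          using N w[of s] dist_bounded[of g1 s g2]
          by (intro mult_mono) (auto simp: scaleR_diff_right[symmetric] dist_norm intro!: mult_left_mono)
        finally show ?thesis by (simp add: w_def algebra_simps)
      qed
    qed (use A0 N in auto)
    then have "inverse (w t) * norm (A g1 t - A g2 t) \<le> 1/2 * dist g1 g2"
      using w[of t] N by (simp add: field_simps)
    moreover have "dist (T0 g1 t) (T0 g2 t) = inverse (w t) * norm (A g1 t - A g2 t)"
      using w[of t] unfolding T0_def dist_norm scaleR_diff_right[symmetric] by simp
    ultimately show "dist (apply_bcontfun (T g1) t) (apply_bcontfun (T g2) t) \<le> 1/2 * dist g1 g2"
      by (simp add: T)
  qed
  then obtain g where g: "T g = g"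
    using banach_fix_type[of "1/2" T] by auto
  define z where "z t = z0 + A g t" for t
  have zg: "z t = w t *\<^sub>R apply_bcontfun g t" for t
  proof -
    have "inverse (w t) *\<^sub>R z t = apply_bcontfun g t"
      using arg_cong[OF g, of "\<lambda>u. apply_bcontfun u t"] by (simp add: T T0_def z_def)
    moreover have "w t *\<^sub>R inverse (w t) *\<^sub>R z t = z t"
      using less_imp_neq[OF w(2)[of t]] by simp
    ultimately show ?thesis by simp
  qed
  have "(z has_vector_derivative f t (z t)) (at t)" for t
  proof -
    have "(z has_vector_derivative 0 + h g t) (at t)"
      unfolding z_def[abs_def] by (intro derivative_intros A)
    then show ?thesis by (simp add: zg h_def)
  qed
  moreover have "z 0 = z0" by (simp add: z_def A0)
  ultimately show ?thesis by blast
qed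

lemma gronwall:
  fixes w :: "real \<Rightarrow> 'a::real_normed_vector"
  assumes deriv: "\<And>t. 0 \<le> t \<Longrightarrow> t \<le> T \<Longrightarrow> (w has_vector_derivative w' t) (at t)"
    and bound: "\<And>t. 0 \<le> t \<Longrightarrow> t \<le> T \<Longrightarrow> norm (w' t) \<le> L * norm (w t) + \<eta>"
    and "L > 0" "\<eta> \<ge> 0" "0 \<le> t" "t \<le> T"
  shows "norm (w t) \<le> 2 * (norm (w 0) + \<eta> * T) * exp (2 * L * T)"
proof -
  have contw: "continuous_on {0..T} w"
    using deriv by (meson atLeastAtMost_iff continuous_at_imp_continuous_on has_vector_derivative_continuous)
  have "continuous_on {0..T} (\<lambda>t. exp (- 2 * L * t) * norm (w t))"
    by (intro continuous_intros contw)
  then obtain \<tau> where \<tau>: "\<tau> \<in> {0..T}"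
    and max: "\<And>t. t \<in> {0..T} \<Longrightarrow> exp (- 2 * L * t) * norm (w t) \<le> exp (- 2 * L * \<tau>) * norm (w \<tau>)"
    using continuous_attains_sup[of "{0..T}" "\<lambda>t. exp (- 2 * L * t) * norm (w t)"] assms(5,6) by auto
  define m where "m = exp (- 2 * L * \<tau>) * norm (w \<tau>)"
  have le: "norm (w s) \<le> m * exp (2 * L * s)" if "s \<in> {0..T}" for s
  proof -
    have "exp (- 2 * L * s) * norm (w s) \<le> m" using max[OF that] by (simp add: m_def)
    then have "exp (2 * L * s) * (exp (- 2 * L * s) * norm (w s)) \<le> exp (2 * L * s) * m"
      by (rule mult_left_mono) simp
    moreover have "exp (2 * L * s) * exp (- 2 * L * s) = 1"
      by (simp add: exp_add[symmetric])
    ultimately show ?thesis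
      by (metis mult.assoc mult.commute mult_1)
  qed
  have "norm (w \<tau>) \<le> norm (w 0) + \<eta> * T + m / 2 * exp (2 * L * \<tau>)"
  proof (cases "\<tau> = 0")
    case True
    then have "0 \<le> m / 2 * exp (2 * L * \<tau>)" and "0 \<le> \<eta> * T"
      using assms by (auto simp: m_def)
    with True show ?thesis by auto
  next
    case False
    have "norm (w \<tau> - w 0) \<le> (m / 2 * exp (2 * L * \<tau>) + \<eta> * \<tau>) - (m / 2 * exp (2 * L * 0) + \<eta> * 0)"
    proof (rule differentiable_bound_general[where f' = w' and \<phi>' = "\<lambda>s. L * m * exp (2 * L * s) + \<eta>"])
      show "0 < \<tau>" using False \<tau> by simp
      show "continuous_on {0..\<tau>} w" using contw \<tau> by (auto intro: continuous_on_subset)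
      show "(w has_vector_derivative w' x) (at x)" if "0 < x" "x < \<tau>" for x
        using deriv that \<tau> by auto
      show "((\<lambda>x. m / 2 * exp (2 * L * x) + \<eta> * x) has_vector_derivative L * m * exp (2 * L * x) + \<eta>) (at x)" for x
        by (auto intro!: derivative_eq_intros simp: has_real_derivative_iff_has_vector_derivative[symmetric])
      show "norm (w' x) \<le> L * m * exp (2 * L * x) + \<eta>" if "0 < x" "x < \<tau>" for x
      proof -
        have "L * norm (w x) \<le> L * (m * exp (2 * L * x))"
          using le[of x] that \<tau> \<open>L > 0\<close> by (intro mult_left_mono) auto
        with bound[of x] that \<tau> show ?thesis by (simp only: mult.assoc) simp
      qed
    qed (auto intro!: continuous_intros)
    moreover have "norm (w \<tau>) \<le> norm (w 0) + norm (w \<tau> - w 0)"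
      using norm_triangle_sub by blast
    moreover have "\<eta> * \<tau> \<le> \<eta> * T" using \<tau> assms by (intro mult_left_mono) auto
    moreover have "m \<ge> 0" by (simp add: m_def)
    ultimately show ?thesis by simp
  qed
  then have "exp (- 2 * L * \<tau>) * norm (w \<tau>)
      \<le> exp (- 2 * L * \<tau>) * (norm (w 0) + \<eta> * T + m / 2 * exp (2 * L * \<tau>))"
    by (rule mult_left_mono) simp
  also have "\<dots> = exp (- 2 * L * \<tau>) * (norm (w 0) + \<eta> * T) + m / 2"
    by (simp add: exp_minus distrib_left)
  finally have "exp (- 2 * L * \<tau>) * norm (w \<tau>)
      \<le> exp (- 2 * L * \<tau>) * (norm (w 0) + \<eta> * T) + m / 2" .
  moreover have "exp (- 2 * L * \<tau>) * (norm (w 0) + \<eta> * T) \<le> 1 * (norm (w 0) + \<eta> * T)"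
    using assms \<tau> by (intro mult_right_mono) auto
  ultimately have "m \<le> 2 * (norm (w 0) + \<eta> * T)"
    by (simp add: m_def)
  moreover have "exp (2 * L * t) \<le> exp (2 * L * T)"
    using assms by simp
  ultimately have "m * exp (2 * L * t) \<le> 2 * (norm (w 0) + \<eta> * T) * exp (2 * L * T)"
    using assms by (intro mult_mono) auto
  with le[of t] assms show ?thesis by simp
qed

lemma ode_solution_unique:
  fixes z1 z2 :: "real \<Rightarrow> 'a::real_normed_vector"
  assumes lip: "\<And>t a b. norm (f t a - f t b) \<le> L * norm (a - b)"
    and z1: "\<And>t. (z1 has_vector_derivative f t (z1 t)) (at t)"
    and z2: "\<And>t. (z2 has_vector_derivative f t (z2 t)) (at t)"
    and init: "z1 0 = z2 0"
  shows "z1 = z2"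
proof
  fix t :: real
  define M where "M = max 1 L"
  have lipM: "norm (f t a - f t b) \<le> M * norm (a - b)" for t a b
    using lip[of t a b] mult_right_mono[of L M "norm (a - b)"] by (simp add: M_def)
  show "z1 t = z2 t"
  proof (cases "t \<ge> 0")
    case True
    have "norm (z1 t - z2 t) \<le> 2 * (norm (z1 0 - z2 0) + 0 * t) * exp (2 * M * t)"
      by (rule gronwall[where w' = "\<lambda>t. f t (z1 t) - f t (z2 t)"])
        (use True lipM in \<open>auto simp: M_def intro!: derivative_intros z1 z2\<close>)
    then show ?thesis using init by simp
  next
    case False
    have "norm (z1 (- (- t)) - z2 (- (- t))) \<le> 2 * (norm (z1 (- 0) - z2 (- 0)) + 0 * (- t)) * exp (2 * M * (- t))"
      by (rule gronwall[where w' = "\<lambda>t. - f (- t) (z1 (- t)) - - f (- t) (z2 (- t))"])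
        (use False lipM in \<open>auto simp: M_def minus_diff_minus
            simp del: minus_diff_eq diff_minus_eq_add uminus_add_conv_diff
            intro!: has_vector_derivative_diff has_vector_derivative_reflect z1 z2\<close>)
    then show ?thesis using init by simp
  qed
qed

lemma ode_solution_continuous_dependence:
  fixes z :: "'p::metric_space \<Rightarrow> real \<Rightarrow> 'a::real_normed_vector"
  assumes cont: "continuous_on (UNIV \<times> {0..T} \<times> UNIV) (\<lambda>(l, t, x). f l t x)"
    and lip: "\<And>l t a b. norm (f l t a - f l t b) \<le> L * norm (a - b)"
    and z: "\<And>l t. (z l has_vector_derivative f l t (z l t)) (at t)"
    and init: "continuous_on UNIV (\<lambda>l. z l 0)"
  shows "continuous_on (UNIV \<times> {0..T}) (\<lambda>(l, t). z l t)"
proof -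
  define M where "M = max 1 L"
  have lipM: "norm (f l t a - f l t b) \<le> M * norm (a - b)" for l t a b
    using lip[of l t a b] mult_right_mono[of L M "norm (a - b)"] by (simp add: M_def)
  have contz: "isCont (z l) t" for l t
    using z has_vector_derivative_continuous by blast
  have contz': "continuous_on UNIV (z l)" for l
    using contz by (simp add: continuous_at_imp_continuous_on)
  have unif: "\<forall>\<^sub>F l in nhds l0. \<forall>t\<in>{0..T}. dist (z l t) (z l0 t) < e" if "e > 0" for l0 e
  proof (cases "T \<ge> 0")
    case True
    define E where "E = 2 * (1 + T) * exp (2 * M * T)"
    have E: "E > 0" using True by (auto simp: E_def intro!: mult_pos_pos)
    define \<eta> where "\<eta> = e / (2 * E)"
    have \<eta>: "\<eta> > 0" using E that by (simp add: \<eta>_def)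
    have "continuous_on (UNIV \<times> {0..T}) (\<lambda>p. (fst p, snd p, z l0 (snd p)))"
      by (intro continuous_intros continuous_on_compose2[OF contz']) auto
    then have "continuous_on (UNIV \<times> {0..T})
        (\<lambda>p. (\<lambda>(l, t, x). f l t x) (fst p, snd p, z l0 (snd p)))"
      by (rule continuous_on_compose2[OF cont]) force
    then have "continuous_on (UNIV \<times> {0..T}) (\<lambda>(l, t). f l t (z l0 t))"
      by (simp add: case_prod_unfold)
    then obtain X0 where X0: "l0 \<in> X0" "open X0"
      and dX: "\<forall>l\<in>X0 \<inter> UNIV. \<forall>t\<in>{0..T}.
        dist ((\<lambda>(l, t). f l t (z l0 t)) (l, t)) ((\<lambda>(l, t). f l t (z l0 t)) (l0, t)) \<le> \<eta>"
      by (rule continuous_on_prod_compactE[OF _ compact_Icc UNIV_I \<eta>])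
    have fX: "dist (f l t (z l0 t)) (f l0 t (z l0 t)) \<le> \<eta>" if "l \<in> X0" "t \<in> {0..T}" for l t
      using dX that by simp
    have "isCont (\<lambda>l. z l 0) l0"
      using init continuous_on_eq_continuous_at open_UNIV by blast
    then have "\<forall>\<^sub>F l in at l0. dist (z l 0) (z l0 0) < \<eta>"
      unfolding isCont_def using \<eta> by (rule tendstoD)
    then have "\<forall>\<^sub>F l in nhds l0. dist (z l 0) (z l0 0) < \<eta>"
      unfolding eventually_at_filter by (rule eventually_mono) (use \<eta> in auto)
    moreover have "\<forall>\<^sub>F l in nhds l0. l \<in> X0"
      using X0 eventually_nhds by blast
    ultimately show ?thesis
    proof eventually_elim
      case (elim l)
      show ?case
      proof
        fix t assume t: "t \<in> {0..T}"
        have "norm (z l t - z l0 t) \<le> 2 * (norm (z l 0 - z l0 0) + \<eta> * T) * exp (2 * M * T)"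
        proof (rule gronwall[where w' = "\<lambda>t. f l t (z l t) - f l0 t (z l0 t)"])
          show "((\<lambda>t. z l t - z l0 t) has_vector_derivative f l s (z l s) - f l0 s (z l0 s)) (at s)" for s
            by (intro derivative_intros z)
          show "norm (f l s (z l s) - f l0 s (z l0 s)) \<le> M * norm (z l s - z l0 s) + \<eta>"
            if "0 \<le> s" "s \<le> T" for s
          proof -
            have "f l s (z l s) - f l0 s (z l0 s)
              = (f l s (z l s) - f l s (z l0 s)) + (f l s (z l0 s) - f l0 s (z l0 s))" by simp
            also have "norm \<dots> \<le> M * norm (z l s - z l0 s) + \<eta>"
              using fX[of l s] elim that lipM by (intro norm_triangle_mono) (auto simp: dist_norm)
            finally show ?thesis .
          qed
        qed (use \<eta> t in \<open>auto simp: M_def\<close>)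
        also have "\<dots> \<le> 2 * (\<eta> + \<eta> * T) * exp (2 * M * T)"
          using elim by (intro mult_mono) (auto simp: dist_norm True \<eta> less_imp_le)
        also have "\<dots> = \<eta> * E" by (simp add: E_def algebra_simps)
        also have "\<dots> < e" using E that by (simp add: \<eta>_def)
        finally show "dist (z l t) (z l0 t) < e" by (simp add: dist_norm)
      qed
    qed
  qed auto
  show ?thesis
    unfolding continuous_on_def
  proof
    fix q :: "'p \<times> real"
    obtain l0 t0 where q: "q = (l0, t0)" by (cases q)
    show "((\<lambda>(l, t). z l t) \<longlongrightarrow> (case q of (l, t) \<Rightarrow> z l t)) (at q within UNIV \<times> {0..T})"
      unfolding q
    proof (rule tendstoI)
      fix e :: real assume e: "e > 0"
      have "\<forall>\<^sub>F p in nhds (l0, t0). \<forall>t\<in>{0..T}. dist (z (fst p) t) (z l0 t) < e/2"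
        unfolding nhds_prod using unif[of "e/2" l0] e filterlim_fst
        by (auto simp: filterlim_iff)
      moreover have "\<forall>\<^sub>F t in nhds t0. dist (z l0 t) (z l0 t0) < e/2"
        by (rule tendstoD[OF contz[where l = l0 and t = t0, unfolded isCont_def tendsto_at_iff_tendsto_nhds] half_gt_zero[OF e]])
      then have "\<forall>\<^sub>F p in nhds (l0, t0). dist (z l0 (snd p)) (z l0 t0) < e/2"
        unfolding nhds_prod using filterlim_snd by (auto simp: filterlim_iff)
      ultimately have "\<forall>\<^sub>F p in nhds (l0, t0). snd p \<in> {0..T} \<longrightarrow> dist (z (fst p) (snd p)) (z l0 t0) < e"
      proof eventually_elim
        case (elim p)
        then show ?case
          using dist_triangle[of "z (fst p) (snd p)" "z l0 t0" "z l0 (snd p)"] by fastforce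
      qed
      then show "\<forall>\<^sub>F p in at (l0, t0) within UNIV \<times> {0..T}.
          dist (case p of (l, t) \<Rightarrow> z l t) (case (l0, t0) of (l, t) \<Rightarrow> z l t) < e"
        unfolding eventually_at_filter by eventually_elim auto
    qed
  qed
qed

lemma norm_second_order_field_diff_le:
  fixes x y v w :: "'a::real_normed_vector"
  assumes "norm (a - b) \<le> L * norm (x - y)" "L \<ge> 0"
  shows "norm ((v + q, a) - (w + q, b)) \<le> (1 + L) * norm ((x, v) - (y, w))"
proof -
  have "norm ((v + q, a) - (w + q, b)) \<le> norm (v - w) + norm (a - b)"
    using norm_Pair_le[of "v - w" "a - b"] by simp
  also have "\<dots> \<le> norm ((x, v) - (y, w)) + L * norm ((x, v) - (y, w))"
    using assms norm_snd_le[of "v - w" "x - y"] mult_left_mono[OF norm_fst_le[of "x - y" "v - w"], of L]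
    by simp
  finally show ?thesis by (simp add: algebra_simps)
qed

lemma second_order_solution_exists:
  fixes g :: "real \<Rightarrow> 'a::euclidean_space \<Rightarrow> 'a"
  assumes contg: "continuous_on UNIV (\<lambda>(t, x). g t x)" and contq: "continuous_on UNIV q"
    and lip: "\<And>t x y. norm (g t x - g t y) \<le> L * norm (x - y)" "L \<ge> 0"
    and growth: "\<And>t. norm (g t 0) \<le> C * exp \<bar>t\<bar>" "\<And>t. norm (q t) \<le> C * exp \<bar>t\<bar>"
  shows "\<exists>x v. x 0 = a \<and> v 0 = b \<and> (\<forall>t. (x has_vector_derivative v t + q t) (at t) \<and>
    (v has_vector_derivative g t (x t)) (at t))"
proof -
  define f where "f = (\<lambda>t (x, v). (v + q t, g t x))"
  have "continuous_on UNIV (\<lambda>p. (\<lambda>(t, x). g t x) (fst p, fst (snd p)))"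
    by (rule continuous_on_compose2[OF contg]) (auto intro!: continuous_intros)
  then have "continuous_on UNIV (\<lambda>p. (snd (snd p) + q (fst p), g (fst p) (fst (snd p))))"
    by (auto intro!: continuous_intros continuous_on_compose2[OF contq])
  then have "continuous_on UNIV (\<lambda>(t, z). f t z)"
    by (simp add: f_def case_prod_unfold)
  moreover have "norm (f t z1 - f t z2) \<le> (1 + L) * norm (z1 - z2)" for t z1 z2
    using norm_second_order_field_diff_le[OF lip] by (cases z1; cases z2) (simp add: f_def)
  moreover have "norm (f t 0) \<le> (2 * C) * exp (1 * \<bar>t\<bar>)" for t
    using norm_Pair_le[of "q t" "g t 0"] growth[of t] by (simp add: f_def zero_prod_def)
  ultimately obtain z where z: "z 0 = (a, b)" "\<And>t. (z has_vector_derivative f t (z t)) (at t)"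
    using ode_solution_exists[of f "1 + L" "2 * C" 1 "(a, b)"] by blast
  have "((\<lambda>t. fst (z t)) has_vector_derivative fst (f t (z t))) (at t)"
    and "((\<lambda>t. snd (z t)) has_vector_derivative snd (f t (z t))) (at t)" for t
    using z(2)[of t] bounded_linear.has_vector_derivative[OF bounded_linear_fst]
      bounded_linear.has_vector_derivative[OF bounded_linear_snd] by blast+
  then show ?thesis
    using z(1) by (intro exI[of _ "\<lambda>t. fst (z t)"] exI[of _ "\<lambda>t. snd (z t)"])
      (auto simp: f_def case_prod_unfold)
qed

lemma second_order_solution_unique:
  fixes g :: "real \<Rightarrow> 'a::real_normed_vector \<Rightarrow> 'a"
  assumes lip: "\<And>t x y. norm (g t x - g t y) \<le> L * norm (x - y)" "L \<ge> 0"
    and sol1: "\<And>t. (x1 has_vector_derivative v1 t + q t) (at t)" "\<And>t. (v1 has_vector_derivative g t (x1 t)) (at t)"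
    and sol2: "\<And>t. (x2 has_vector_derivative v2 t + q t) (at t)" "\<And>t. (v2 has_vector_derivative g t (x2 t)) (at t)"
    and init: "x1 0 = x2 0" "v1 0 = v2 0"
  shows "x1 = x2"
proof -
  have "(\<lambda>t. (x1 t, v1 t)) = (\<lambda>t. (x2 t, v2 t))"
  proof (rule ode_solution_unique[where f = "\<lambda>t (x, v). (v + q t, g t x)" and L = "1 + L"])
    show "norm ((case z1 of (x, v) \<Rightarrow> (v + q t, g t x)) - (case z2 of (x, v) \<Rightarrow> (v + q t, g t x)))
      \<le> (1 + L) * norm (z1 - z2)" for t z1 z2
      using norm_second_order_field_diff_le[OF lip] by (cases z1; cases z2) simp
  qed (use sol1 sol2 init in \<open>auto intro!: has_vector_derivative_Pair\<close>)
  then show ?thesis by (auto simp: fun_eq_iff)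
qed

lemma second_order_continuous_dependence:
  fixes g :: "'p::metric_space \<Rightarrow> real \<Rightarrow> 'a::real_normed_vector \<Rightarrow> 'a"
  assumes contg: "continuous_on (UNIV \<times> {0..T} \<times> UNIV) (\<lambda>(l, t, x). g l t x)"
    and contq: "continuous_on UNIV (\<lambda>(l, t). q l t)"
    and lip: "\<And>l t x y. norm (g l t x - g l t y) \<le> L * norm (x - y)" "L \<ge> 0"
    and sol: "\<And>l t. (x l has_vector_derivative v l t + q l t) (at t)"
      "\<And>l t. (v l has_vector_derivative g l t (x l t)) (at t)"
    and init: "continuous_on UNIV (\<lambda>l. x l 0)" "continuous_on UNIV (\<lambda>l. v l 0)"
  shows "continuous_on (UNIV \<times> {0..T}) (\<lambda>(l, t). x l t)"
    and "continuous_on (UNIV \<times> {0..T}) (\<lambda>(l, t). v l t)"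
proof -
  have "continuous_on (UNIV \<times> {0..T}) (\<lambda>(l, t). (x l t, v l t))"
  proof (rule ode_solution_continuous_dependence[where f = "\<lambda>l t (x, v). (v + q l t, g l t x)" and L = "1 + L"])
    have "continuous_on (UNIV \<times> {0..T} \<times> UNIV) (\<lambda>p. (\<lambda>(l, t, x). g l t x) (fst p, fst (snd p), fst (snd (snd p))))"
      by (rule continuous_on_compose2[OF contg]) (auto intro!: continuous_intros)
    moreover have "continuous_on (UNIV \<times> {0..T} \<times> UNIV) (\<lambda>p. (\<lambda>(l, t). q l t) (fst p, fst (snd p)))"
      by (rule continuous_on_compose2[OF contq]) (auto intro!: continuous_intros)
    ultimately have "continuous_on (UNIV \<times> {0..T} \<times> UNIV)
       (\<lambda>p. (snd (snd (snd p)) + q (fst p) (fst (snd p)), g (fst p) (fst (snd p)) (fst (snd (snd p)))))"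
      by (auto intro!: continuous_intros)
    then show "continuous_on (UNIV \<times> {0..T} \<times> UNIV) (\<lambda>(l, t, x, v). (v + q l t, g l t x))"
      by (simp add: case_prod_unfold)
    show "norm ((case z1 of (x, v) \<Rightarrow> (v + q l t, g l t x)) - (case z2 of (x, v) \<Rightarrow> (v + q l t, g l t x)))
      \<le> (1 + L) * norm (z1 - z2)" for l t z1 z2
      using norm_second_order_field_diff_le[OF lip] by (cases z1; cases z2) simp
  qed (use sol init in \<open>auto intro!: has_vector_derivative_Pair continuous_intros\<close>)
  then have c: "continuous_on (UNIV \<times> {0..T}) (\<lambda>p. (x (fst p) (snd p), v (fst p) (snd p)))"
    by (simp add: case_prod_unfold)
  show "continuous_on (UNIV \<times> {0..T}) (\<lambda>(l, t). x l t)"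
    using continuous_on_fst[OF c] by (simp add: case_prod_unfold)
  show "continuous_on (UNIV \<times> {0..T}) (\<lambda>(l, t). v l t)"
    using continuous_on_snd[OF c] by (simp add: case_prod_unfold)
qed

lemma solves_ode2_ex1:
  fixes g :: "real \<Rightarrow> 'a::euclidean_space \<Rightarrow> 'a"
  assumes cont: "continuous_on UNIV (\<lambda>(t, x). g t x)"
    and lip: "\<And>t x y. norm (g t x - g t y) \<le> L * norm (x - y)" "L \<ge> 0"
    and growth: "\<And>t. norm (g t 0) \<le> C * exp \<bar>t\<bar>"
  shows "\<exists>!x. solves_ode2 g a b x"
proof (rule ex_ex1I)
  have "C \<ge> 0" using order_trans[OF norm_ge_zero growth[of 0]] by simp
  then have "norm ((0::'a)) \<le> C * exp \<bar>t\<bar>" for t :: real by simp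
  with second_order_solution_exists[of g "\<lambda>_. 0" L C a b] assms
  show "\<exists>x. solves_ode2 g a b x"
    unfolding solves_ode2_def by (simp add: continuous_on_const)
next
  fix x y assume "solves_ode2 g a b x" "solves_ode2 g a b y"
  then obtain v w where
    "x 0 = a" "v 0 = b" "\<And>t. (x has_vector_derivative v t) (at t)" "\<And>t. (v has_vector_derivative g t (x t)) (at t)"
    "y 0 = a" "w 0 = b" "\<And>t. (y has_vector_derivative w t) (at t)" "\<And>t. (w has_vector_derivative g t (y t)) (at t)"
    unfolding solves_ode2_def by blast
  then show "x = y"
    by (intro second_order_solution_unique[OF lip, where q = "\<lambda>_. 0" and ?v1.0 = v and ?v2.0 = w]) auto
qed

section \<open>Indefinite integrals of integrable functions\<close>

text \<open>By Vitali's theorem, disjoint bad intervals cover this set up to a null set; finitely many of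
  them form a tagged partial division, to which Henstock's lemma applies.\<close>

lemma negligible_bad_difference_quotients:
  fixes p F :: "real \<Rightarrow> real"
  assumes int: "p integrable_on {a..b}"
    and F: "\<And>s t. a \<le> s \<Longrightarrow> s \<le> t \<Longrightarrow> t \<le> b \<Longrightarrow> F t - F s = integral {s..t} p"
    and "\<eta> > 0"
  shows "negligible {x. a < x \<and> x < b \<and>
    (\<forall>d>0. \<exists>h. h \<noteq> 0 \<and> \<bar>h\<bar> < d \<and> \<bar>F (x + h) - F x - p x * h\<bar> > \<eta> * \<bar>h\<bar>)}" (is "negligible ?S")
  unfolding negligible_outer_le
proof (intro allI impI)
  fix e :: real assume "e > 0"
  with \<open>\<eta> > 0\<close> have "\<eta> * e > 0" by simp
  then obtain \<gamma> where "gauge \<gamma>" and \<gamma>: "\<And>p'. \<lbrakk>p' tagged_partial_division_of {a..b}; \<gamma> fine p'\<rbrakk> \<Longrightarrow>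
             sum (\<lambda>(x,k). norm (measure lborel k *\<^sub>R p x - integral k p)) p' < \<eta> * e"
    using Henstock_lemma[of p a b "\<eta> * e"] int unfolding box_real by blast
  define c where "c = (\<lambda>(x, h). x + h / 2 :: real)"
  define r where "r = (\<lambda>(x :: real, h). \<bar>h\<bar> / 2 :: real)"
  define J where "J i = cball (c i) (r i)" for i
  define K where "K = {(x, h). x \<in> ?S \<and> h \<noteq> 0 \<and> J (x, h) \<subseteq> {a..b} \<inter> \<gamma> x \<and>
      \<bar>F (x + h) - F x - p x * h\<bar> > \<eta> * \<bar>h\<bar>}"
  have J: "J (x, h) = {min x (x + h)..max x (x + h)}" for x h
    by (auto simp: J_def c_def r_def cball_eq_atLeastAtMost min_def max_def abs_if field_simps)
  have cov: "\<exists>i. i \<in> K \<and> x \<in> cball (c i) (r i) \<and> r i < d" if x: "x \<in> ?S" and d: "d > 0" for x d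
  proof -
    have "open (\<gamma> x)" "x \<in> \<gamma> x" using \<open>gauge \<gamma>\<close> by (auto simp: gauge_def)
    then have "open ({a<..<b} \<inter> \<gamma> x)" "x \<in> {a<..<b} \<inter> \<gamma> x" using x by auto
    then obtain \<rho> where \<rho>: "\<rho> > 0" "ball x \<rho> \<subseteq> {a<..<b} \<inter> \<gamma> x"
      by (meson open_contains_ball)
    then obtain h where h: "h \<noteq> 0" "\<bar>h\<bar> < min \<rho> d" "\<bar>F (x + h) - F x - p x * h\<bar> > \<eta> * \<bar>h\<bar>"
      using x d by (auto dest!: spec[of _ "min \<rho> d"])
    have "J (x, h) \<subseteq> ball x \<rho>"
      using h(2) by (auto simp: J dist_real_def min_def max_def split: if_splits)
    also have "\<dots> \<subseteq> {a..b} \<inter> \<gamma> x"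
      using \<rho>(2) by force
    finally have "(x, h) \<in> K" using h x by (simp add: K_def)
    moreover have "x \<in> J (x, h)" by (simp add: J)
    ultimately show ?thesis using h(1,2) by (intro exI[of _ "(x, h)"]) (auto simp: r_def J_def)
  qed
  have rpos: "r i > 0" if "i \<in> K" for i
    using that by (auto simp: K_def r_def)
  obtain C where C: "countable C" "C \<subseteq> K"
     "pairwise (\<lambda>i j. disjnt (cball (c i) (r i)) (cball (c j) (r j))) C"
     "negligible (?S - (\<Union>i \<in> C. cball (c i) (r i)))"
    by (rule Vitali_covering_theorem_cballs[of K r ?S c, OF rpos cov])
  have bound: "measure lebesgue (\<Union>i\<in>I. J i) \<le> e" if I: "I \<subseteq> C" "finite I" for I
  proof -
    have IK: "(x, h) \<in> K" if "(x, h) \<in> I" for x h using that I C by auto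
    have inj: "i = j" if "i \<in> I" "j \<in> I" "J i \<inter> J j \<noteq> {}" for i j
      using C(3) that I unfolding pairwise_def disjnt_def J_def by blast
    define P where "P = (\<lambda>i. (fst i, J i)) ` I"
    have injP: "inj_on (\<lambda>i. (fst i, J i)) I"
    proof (rule inj_onI)
      fix i j assume ij: "i \<in> I" "j \<in> I" "(fst i, J i) = (fst j, J j)"
      moreover have "fst i \<in> J i" using J[of "fst i" "snd i"] by simp
      ultimately have "J i \<inter> J j \<noteq> {}" by auto
      with ij inj show "i = j" by blast
    qed
    have "P tagged_partial_division_of {a..b}"
      unfolding tagged_partial_division_of_def
    proof (intro conjI allI impI)
      show "finite P" using I by (simp add: P_def)
    next
      fix x k assume "(x, k) \<in> P"
      then obtain h where h: "(x, h) \<in> I" "k = J (x, h)" by (auto simp: P_def)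
      then show "x \<in> k" "k \<subseteq> {a..b}" "\<exists>u v. k = cbox u v"
        using IK[OF h(1)] by (auto simp: K_def J simp flip: box_real)
    next
      fix x1 k1 x2 k2 assume *: "(x1, k1) \<in> P \<and> (x2, k2) \<in> P \<and> (x1, k1) \<noteq> (x2, k2)"
      then obtain i j where "i \<in> I" "j \<in> I" "k1 = J i" "k2 = J j" "i \<noteq> j" by (auto simp: P_def)
      with inj have "k1 \<inter> k2 = {}" by blast
      then show "interior k1 \<inter> interior k2 = {}" using interior_subset by blast
    qed
    moreover have "\<gamma> fine P"
      using IK by (fastforce simp: fine_def P_def K_def)
    ultimately have lt: "(\<Sum>(x,k)\<in>P. norm (measure lborel k *\<^sub>R p x - integral k p)) < \<eta> * e"
      by (rule \<gamma>)
    have "\<eta> * measure lebesgue (J i) \<le> norm (measure lborel (J i) *\<^sub>R p (fst i) - integral (J i) p)"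
      if "i \<in> I" for i
    proof -
      obtain x h where i: "i = (x, h)" by (cases i)
      have k: "(x, h) \<in> K" using IK that i by simp
      then have h: "h \<noteq> 0" "J (x, h) \<subseteq> {a..b}" "\<bar>F (x + h) - F x - p x * h\<bar> > \<eta> * \<bar>h\<bar>"
        by (auto simp: K_def)
      show ?thesis
      proof (cases "h > 0")
        case True
        then have "integral {x..x+h} p = F (x + h) - F x"
          using F[of x "x + h"] h(2) by (auto simp: J)
        with True h show ?thesis by (simp add: i J abs_minus_commute mult.commute)
      next
        case False
        then have "integral {x+h..x} p = F x - F (x + h)"
          using F[of "x + h" x] h(1,2) by (auto simp: J)
        with False h show ?thesis by (simp add: i J min_def max_def mult.commute algebra_simps)
      qed
    qed
    then have "\<eta> * (\<Sum>i\<in>I. measure lebesgue (J i))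
        \<le> (\<Sum>i\<in>I. norm (measure lborel (J i) *\<^sub>R p (fst i) - integral (J i) p))"
      unfolding sum_distrib_left by (rule sum_mono)
    also have "\<dots> = (\<Sum>(x,k)\<in>P. norm (measure lborel k *\<^sub>R p x - integral k p))"
      unfolding P_def by (subst sum.reindex[OF injP]) (simp add: o_def)
    finally have "(\<Sum>i\<in>I. measure lebesgue (J i)) \<le> e"
      using lt \<open>\<eta> > 0\<close> by (meson le_less_trans less_imp_le mult_less_cancel_left_pos)
    moreover have "measure lebesgue (\<Union>i\<in>I. J i) \<le> (\<Sum>i\<in>I. measure lebesgue (J i))"
      by (rule measure_UNION_le[OF I(2)]) (auto simp: J_def)
    ultimately show ?thesis by linarith
  qed
  define U where "U = (\<Union>i\<in>C. J i)"
  have U: "U \<in> lmeasurable" "measure lebesgue U \<le> e"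
    using fmeasurable_UN_bound[OF C(1) _ bound] measure_UN_bound[OF C(1) _ bound]
    by (auto simp: U_def J_def)
  have N: "negligible (?S - U)" using C(4) by (simp add: U_def J_def)
  show "\<exists>T. ?S \<subseteq> T \<and> T \<in> lmeasurable \<and> measure lebesgue T \<le> e"
  proof (intro exI conjI)
    show "?S \<subseteq> U \<union> (?S - U)" by auto
    show "U \<union> (?S - U) \<in> lmeasurable"
      using U(1) negligible_imp_measurable[OF N] by (rule fmeasurable.Un)
    have "measure lebesgue (U \<union> (?S - U)) = measure lebesgue U"
      using measure_Un_null_set[OF fmeasurableD[OF U(1)] N[unfolded negligible_iff_null_sets]] .
    with U(2) show "measure lebesgue (U \<union> (?S - U)) \<le> e" by simp
  qed
qed

lemma AE_has_derivative_indefinite_integral: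
  fixes p F :: "real \<Rightarrow> real"
  assumes int: "\<And>a b. p integrable_on {a..b}"
    and F: "\<And>s t. s \<le> t \<Longrightarrow> F t - F s = integral {s..t} p"
  shows "AE t in lebesgue. (F has_real_derivative p t) (at t)"
proof -
  define S where "S n k = {x. - real n < x \<and> x < real n \<and>
    (\<forall>d>0. \<exists>h. h \<noteq> 0 \<and> \<bar>h\<bar> < d \<and> \<bar>F (x + h) - F x - p x * h\<bar> > inverse (real (Suc k)) * \<bar>h\<bar>)}"
    for n k :: nat
  have "negligible (S n k)" for n k
    unfolding S_def by (rule negligible_bad_difference_quotients) (use int F in auto)
  then have "negligible (\<Union>n. \<Union>k. S n k)"
    by (intro negligible_countable_Union) (auto intro: negligible_countable_Union)
  then have "AE t in lebesgue. t \<notin> (\<Union>n. \<Union>k. S n k)"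
    unfolding negligible_iff_null_sets by (rule AE_not_in)
  then show ?thesis
  proof (rule AE_mp, intro AE_I2 impI)
    fix t assume t: "t \<notin> (\<Union>n. \<Union>k. S n k)"
    obtain n :: nat where n: "\<bar>t\<bar> < real n" using reals_Archimedean2 by blast
    show "(F has_real_derivative p t) (at t)"
      unfolding DERIV_def
    proof (rule tendstoI)
      fix e :: real assume "e > 0"
      then obtain k where k: "inverse (real (Suc k)) < e" using reals_Archimedean by blast
      from t have "t \<notin> S n k" by auto
      with n have "\<exists>d>0. \<forall>h. h \<noteq> 0 \<longrightarrow> \<bar>h\<bar> < d \<longrightarrow>
          \<bar>F (t + h) - F t - p t * h\<bar> \<le> inverse (real (Suc k)) * \<bar>h\<bar>"
        unfolding S_def mem_Collect_eq not_less[symmetric] by (simp add: abs_less_iff) blast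
      then obtain d where d: "d > 0"
        "\<And>h. h \<noteq> 0 \<Longrightarrow> \<bar>h\<bar> < d \<Longrightarrow> \<bar>F (t + h) - F t - p t * h\<bar> \<le> inverse (real (Suc k)) * \<bar>h\<bar>"
        by blast
      have "dist ((F (t + h) - F t) / h) (p t) < e" if "h \<noteq> 0" "\<bar>h\<bar> < d" for h
      proof -
        have "(F (t + h) - F t) / h - p t = (F (t + h) - F t - p t * h) / h"
          using that by (simp add: field_simps)
        then have "dist ((F (t + h) - F t) / h) (p t) = \<bar>F (t + h) - F t - p t * h\<bar> / \<bar>h\<bar>"
          by (simp add: dist_real_def)
        also have "\<dots> \<le> inverse (real (Suc k))"
          using d(2)[OF that] that(1) by (simp add: pos_divide_le_eq)
        finally show ?thesis using k by simp
      qed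
      then show "\<forall>\<^sub>F h in at 0. dist ((F (t + h) - F t) / h) (p t) < e"
        unfolding eventually_at using d(1) by (auto simp: dist_real_def)
    qed
  qed
qed

lemma absolutely_continuous_indefinite_integral:
  fixes p F :: "real \<Rightarrow> real"
  assumes int: "\<And>a b. p absolutely_integrable_on {a..b}"
    and F: "\<And>s t. s \<le> t \<Longrightarrow> F t - F s = integral {s..t} p"
  shows "absolutely_continuous_on_interval a b F"
  unfolding absolutely_continuous_on_interval_def
proof (intro allI impI)
  fix e :: real assume e: "e > 0"
  define G where "G x = indicator {a..b} x * \<bar>p x\<bar>" for x
  have G0: "G x \<ge> 0" for x by (simp add: G_def)
  have intG: "integrable lebesgue G"
    using integrable_abs[OF int[of a b, unfolded set_integrable_def]]
    by (simp add: G_def[abs_def] abs_mult)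
  have intM: "integrable lebesgue (\<lambda>x. min (G x) (real n))" for n
    by (rule Bochner_Integration.integrable_bound[OF intG]) (use intG G0 in auto)
  have "(\<lambda>n. LINT x|lebesgue. G x - min (G x) (real n)) \<longlonglongrightarrow> (LINT x::real|lebesgue. 0)"
  proof (rule integral_dominated_convergence[where w = G])
    show "AE x in lebesgue. (\<lambda>n. G x - min (G x) (real n)) \<longlonglongrightarrow> 0"
    proof (intro AE_I2 tendsto_eventually)
      fix x
      obtain m :: nat where "G x \<le> real m" using real_arch_simple by blast
      then show "\<forall>\<^sub>F n in sequentially. G x - min (G x) (real n) = 0"
        unfolding eventually_sequentially by (intro exI[of _ m]) auto
    qed
    show "AE x in lebesgue. norm (G x - min (G x) (real n)) \<le> G x" for n
      using G0 by (intro AE_I2) (auto simp: min_def)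
  qed (use intG in auto)
  then have "\<forall>\<^sub>F n in sequentially. (LINT x|lebesgue. G x - min (G x) (real n)) < e / 2"
    using e by (intro order_tendstoD(2)[where y = 0]) auto
  then obtain N where N: "(LINT x|lebesgue. G x - min (G x) (real N)) < e / 2"
    unfolding eventually_sequentially by blast
  define H where "H x = G x - min (G x) (real N)" for x
  have intH: "integrable lebesgue H" and H0: "\<And>x. H x \<ge> 0"
    unfolding H_def using intG intM[of N] by auto
  show "\<exists>d>0. \<forall>(n::nat) u v.
        (\<forall>i<n. a \<le> u i \<and> u i \<le> v i \<and> v i \<le> b) \<and>
        disjoint_family_on (\<lambda>i. {u i<..<v i}) {..<n} \<and> (\<Sum>i<n. v i - u i) < d
        \<longrightarrow> (\<Sum>i<n. \<bar>F (v i) - F (u i)\<bar>) < e"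
  proof (intro exI[of _ "e / (2 * (real N + 1))"] conjI allI impI)
    show "e / (2 * (real N + 1)) > 0" using e by simp
    fix n :: nat and u v :: "nat \<Rightarrow> real"
    assume "(\<forall>i<n. a \<le> u i \<and> u i \<le> v i \<and> v i \<le> b) \<and>
        disjoint_family_on (\<lambda>i. {u i<..<v i}) {..<n} \<and>
        (\<Sum>i<n. v i - u i) < e / (2 * (real N + 1))"
    then have uv: "\<And>i. i < n \<Longrightarrow> a \<le> u i \<and> u i \<le> v i \<and> v i \<le> b"
      and disj: "disjoint_family_on (\<lambda>i. {u i<..<v i}) {..<n}"
      and small: "(\<Sum>i<n. v i - u i) < e / (2 * (real N + 1))" by auto
    define I where "I i x = (indicator {u i<..<v i} x :: real)" for i x
    have intIH: "integrable lebesgue (\<lambda>x. I i x * H x)" for i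
      unfolding I_def using integrable_mult_indicator[OF _ intH, of "{u i<..<v i}"] by simp
    have intIG: "integrable lebesgue (\<lambda>x. I i x * G x)" for i
      unfolding I_def using integrable_mult_indicator[OF _ intG, of "{u i<..<v i}"] by simp
    have intI: "integrable lebesgue (I i)" for i
      unfolding I_def by (rule integrable_real_indicator) (auto simp: emeasure_lborel_box_eq simp flip: box_real(1))
    have le: "\<bar>F (v i) - F (u i)\<bar> \<le> (LINT x|lebesgue. I i x * H x) + real N * (v i - u i)"
      if i: "i < n" for i
    proof -
      have sub: "p absolutely_integrable_on {u i<..<v i}"
        by (rule set_integrable_subset[OF int[of "u i" "v i"]]) auto
      have "F (v i) - F (u i) = integral {u i<..<v i} p"
        using F[of "u i" "v i"] uv[OF i] integral_open_interval_real[of "u i" "v i" p] by simp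
      also have "\<dots> = (LINT x:{u i<..<v i}|lebesgue. p x)"
        using set_lebesgue_integral_eq_integral(2)[OF sub] by simp
      finally have "\<bar>F (v i) - F (u i)\<bar> \<le> (LINT x:{u i<..<v i}|lebesgue. norm (p x))"
        using set_integral_norm_bound[OF sub] by simp
      also have "\<dots> = (LINT x|lebesgue. I i x * G x)"
        unfolding set_lebesgue_integral_def I_def G_def
        by (rule Bochner_Integration.integral_cong) (use uv[OF i] in \<open>auto simp: indicator_def\<close>)
      also have "\<dots> \<le> (LINT x|lebesgue. I i x * H x + real N * I i x)"
      proof (rule integral_mono[OF intIG])
        show "integrable lebesgue (\<lambda>x. I i x * H x + real N * I i x)"
          by (intro Bochner_Integration.integrable_add integrable_mult_right intIH intI)
        show "I i x * G x \<le> I i x * H x + real N * I i x" for x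
          by (auto simp: I_def H_def indicator_def)
      qed
      also have "\<dots> = (LINT x|lebesgue. I i x * H x) + real N * (v i - u i)"
        using intIH[of i] uv[OF i] by (subst Bochner_Integration.integral_add) (auto simp: I_def)
      finally show ?thesis .
    qed
    have "(\<Sum>i<n. \<bar>F (v i) - F (u i)\<bar>) \<le> (\<Sum>i<n. (LINT x|lebesgue. I i x * H x) + real N * (v i - u i))"
      using le by (intro sum_mono) auto
    also have "\<dots> = (\<Sum>i<n. (LINT x|lebesgue. I i x * H x)) + real N * (\<Sum>i<n. v i - u i)"
      by (simp add: sum.distrib sum_distrib_left)
    also have "(\<Sum>i<n. (LINT x|lebesgue. I i x * H x)) = (LINT x|lebesgue. (\<Sum>i<n. I i x) * H x)"
      using intIH by (simp add: Bochner_Integration.integral_sum sum_distrib_right)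
    also have "\<dots> \<le> (LINT x|lebesgue. H x)"
    proof (rule integral_mono[OF _ intH])
      show "integrable lebesgue (\<lambda>x. (\<Sum>i<n. I i x) * H x)"
        using intIH by (simp add: sum_distrib_right)
      have "(\<Sum>i<n. I i x) = indicator (\<Union>i<n. {u i<..<v i}) x" for x
        unfolding I_def by (rule indicator_UN_disjoint[OF finite_lessThan disj, symmetric])
      then have "(\<Sum>i<n. I i x) \<le> 1" for x
        by (simp add: indicator_def)
      then show "(\<Sum>i<n. I i x) * H x \<le> H x" for x
        using mult_right_mono[of "\<Sum>i<n. I i x" 1 "H x"] H0[of x] by simp
    qed
    also have "real N * (\<Sum>i<n. v i - u i) \<le> (real N + 1) * (e / (2 * (real N + 1)))"
      using small uv by (intro mult_mono) (auto intro!: sum_nonneg)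
    also have "\<dots> = e / 2" 
      by (subst mult.commute[of 2], simp only: times_divide_eq_right, rule mult_divide_mult_cancel_left) linarith
    finally show "(\<Sum>i<n. \<bar>F (v i) - F (u i)\<bar>) < e" using N by (simp add: H_def)
  qed
qed

lemma eq_if_increments_le_mult:
  fixes N :: "real \<Rightarrow> 'a::real_normed_vector"
  assumes incr: "\<And>s t. 0 \<le> s \<Longrightarrow> s \<le> t \<Longrightarrow> t \<le> T \<Longrightarrow> norm (N t - N s) \<le> B * (t - s) * (P t - P s)"
    and "T \<ge> 0"
  shows "N T = N 0"
proof -
  have le: "norm (N T - N 0) \<le> B * T * (P T - P 0) * inverse (real (Suc n))" for n
  proof -
    define \<tau> where "\<tau> i = T * real i / real (Suc n)" for i
    have \<tau>3: "\<tau> (Suc i) - \<tau> i = T / real (Suc n)" for i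
      unfolding \<tau>_def diff_divide_distrib[symmetric] by (simp add: algebra_simps)
    moreover have "T / real (Suc n) \<ge> 0" using \<open>T \<ge> 0\<close> by simp
    ultimately have \<tau>: "0 \<le> \<tau> i" "\<tau> i \<le> \<tau> (Suc i)" for i
      using \<open>T \<ge> 0\<close> \<tau>3[of i] by (simp add: \<tau>_def, linarith)
    have \<tau>T: "\<tau> i \<le> T" if "i \<le> Suc n" for i
      using \<open>T \<ge> 0\<close> that by (simp add: \<tau>_def pos_divide_le_eq mult_left_mono)
    have end_pts: "\<tau> (Suc n) = T" "\<tau> 0 = 0"
      unfolding \<tau>_def by (simp_all only: of_nat_0 mult_zero_right div_0) simp
    have "N T - N 0 = (\<Sum>i<Suc n. N (\<tau> (Suc i)) - N (\<tau> i))"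
      using sum_lessThan_telescope[of "\<lambda>i. N (\<tau> i)" "Suc n"] end_pts by simp
    also have "norm \<dots> \<le> (\<Sum>i<Suc n. B * (T / real (Suc n)) * (P (\<tau> (Suc i)) - P (\<tau> i)))"
    proof (rule sum_norm_le)
      fix i assume "i \<in> {..<Suc n}"
      then show "norm (N (\<tau> (Suc i)) - N (\<tau> i)) \<le> B * (T / real (Suc n)) * (P (\<tau> (Suc i)) - P (\<tau> i))"
        using incr[of "\<tau> i" "\<tau> (Suc i)"] \<tau>[of i] \<tau>3[of i] \<tau>T[of "Suc i"] by simp
    qed
    also have "\<dots> = B * (T / real (Suc n)) * (P T - P 0)"
      using sum_lessThan_telescope[of "\<lambda>i. P (\<tau> i)" "Suc n"] end_pts
      by (simp only: sum_distrib_left[symmetric])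
    finally show ?thesis by (simp add: divide_inverse algebra_simps)
  qed
  have "(\<lambda>n. B * T * (P T - P 0) * inverse (real (Suc n))) \<longlonglongrightarrow> B * T * (P T - P 0) * 0"
    by (intro tendsto_intros LIMSEQ_inverse_real_of_nat)
  then have "norm (N T - N 0) \<le> B * T * (P T - P 0) * 0"
    by (rule LIMSEQ_le_const) (use le in auto)
  then show ?thesis by simp
qed

text \<open>Both remainders of the product rule on \<open>{s..t}\<close> are at most \<open>B (t - s) \<integral> \<bar>p\<bar>\<close>, so they disappear
  under refinement although \<open>F\<close> need not be differentiable everywhere.\<close>

lemma integral_by_parts_indefinite_integral:
  fixes p F :: "real \<Rightarrow> real" and \<psi> :: "real \<Rightarrow> 'a::euclidean_space"
  assumes int: "\<And>a b. p absolutely_integrable_on {a..b}"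
    and F: "\<And>s t. s \<le> t \<Longrightarrow> F t - F s = integral {s..t} p"
    and contF: "continuous_on UNIV F"
    and \<psi>: "\<And>t. (\<psi> has_vector_derivative \<psi>' t) (at t)"
    and cont\<psi>': "continuous_on UNIV \<psi>'"
    and "T \<ge> 0"
  shows "(\<lambda>t. p t *\<^sub>R \<psi> t) absolutely_integrable_on {0..T}"
    and "integral {0..T} (\<lambda>t. p t *\<^sub>R \<psi> t) = F T *\<^sub>R \<psi> T - F 0 *\<^sub>R \<psi> 0 - integral {0..T} (\<lambda>t. F t *\<^sub>R \<psi>' t)"
proof -
  have cont\<psi>: "continuous_on UNIV \<psi>"
    using \<psi> by (meson continuous_at_imp_continuous_on has_vector_derivative_continuous)
  have absint: "(\<lambda>\<tau>. p \<tau> *\<^sub>R k \<tau>) absolutely_integrable_on {s..t}"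
    if "continuous_on UNIV k" for k :: "real \<Rightarrow> 'a" and s t
  proof -
    have "bilinear (\<lambda>(x::'a) (c::real). c *\<^sub>R x)"
      by (auto simp: bilinear_def linear_iff algebra_simps)
    moreover have ck: "continuous_on {s..t} k" using that continuous_on_subset by blast
    moreover have "k \<in> borel_measurable (lebesgue_on {s..t})"
      by (rule continuous_imp_measurable_on_sets_lebesgue[OF ck]) auto
    moreover have "bounded (k ` {s..t})"
      by (intro compact_imp_bounded compact_continuous_image ck) auto
    ultimately show ?thesis
      using absolutely_integrable_bounded_measurable_product[of "\<lambda>x c. c *\<^sub>R x" k "{s..t}" p] int[of s t]
      by auto
  qed
  show "(\<lambda>t. p t *\<^sub>R \<psi> t) absolutely_integrable_on {0..T}"
    by (rule absint[OF cont\<psi>])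
  have i1: "(\<lambda>\<tau>. p \<tau> *\<^sub>R k \<tau>) integrable_on {s..t}" if "continuous_on UNIV k" for k :: "real \<Rightarrow> 'a" and s t
    using absint[OF that] set_lebesgue_integral_eq_integral(1) by blast
  have i2: "k integrable_on {s..t}" if "continuous_on UNIV k" for k :: "real \<Rightarrow> 'a" and s t
    using that by (meson continuous_on_subset integrable_continuous_real subset_UNIV)
  have ip: "(\<lambda>\<tau>. \<bar>p \<tau>\<bar>) integrable_on {s..t}" "p integrable_on {s..t}" for s t
    using int[of s t] by (simp_all add: absolutely_integrable_on_def)
  have contF\<psi>': "continuous_on UNIV (\<lambda>\<tau>. F \<tau> *\<^sub>R \<psi>' \<tau>)"
    by (intro continuous_intros contF cont\<psi>')
  have "bounded (\<psi>' ` {0..T})"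
    by (intro compact_imp_bounded compact_continuous_image continuous_on_subset[OF cont\<psi>']) auto
  then obtain B where B: "B > 0" "\<And>\<tau>. \<tau> \<in> {0..T} \<Longrightarrow> norm (\<psi>' \<tau>) \<le> B"
    unfolding bounded_pos by blast
  define P where "P t = integral {0..t} (\<lambda>\<tau>. \<bar>p \<tau>\<bar>)" for t
  define N where "N t = integral {0..t} (\<lambda>\<tau>. p \<tau> *\<^sub>R \<psi> \<tau>) - F t *\<^sub>R \<psi> t
      + integral {0..t} (\<lambda>\<tau>. F \<tau> *\<^sub>R \<psi>' \<tau>)" for t
  have "norm (N t - N s) \<le> (2 * B) * (t - s) * (P t - P s)" if st: "0 \<le> s" "s \<le> t" "t \<le> T" for s t
  proof -
    have P: "P t - P s = integral {s..t} (\<lambda>\<tau>. \<bar>p \<tau>\<bar>)"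
      using Henstock_Kurzweil_Integration.integral_combine[OF st(1,2) ip(1)[of 0 t]]
      by (simp add: P_def)
    have d\<psi>: "\<psi> t - \<psi> s = integral {s..t} \<psi>'"
      using fundamental_theorem_of_calculus[OF st(2), of \<psi> \<psi>'] \<psi>
      by (metis has_vector_derivative_at_within integral_unique)
    have "N t - N s = integral {s..t} (\<lambda>\<tau>. p \<tau> *\<^sub>R \<psi> \<tau>) + integral {s..t} (\<lambda>\<tau>. F \<tau> *\<^sub>R \<psi>' \<tau>)
        - (F t *\<^sub>R \<psi> t - F s *\<^sub>R \<psi> s)"
      using Henstock_Kurzweil_Integration.integral_combine[OF st(1,2) i1[OF cont\<psi>, of 0 t]]
        Henstock_Kurzweil_Integration.integral_combine[OF st(1,2) i2[OF contF\<psi>', of 0 t]]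
      by (simp add: N_def algebra_simps)
    also have "F t *\<^sub>R \<psi> t - F s *\<^sub>R \<psi> s = integral {s..t} (\<lambda>\<tau>. p \<tau> *\<^sub>R \<psi> t) + integral {s..t} (\<lambda>\<tau>. F s *\<^sub>R \<psi>' \<tau>)"
    proof -
      have "integral {s..t} (\<lambda>\<tau>. p \<tau> *\<^sub>R \<psi> t) = (F t - F s) *\<^sub>R \<psi> t"
        using integral_linear[OF ip(2)[of s t] bounded_linear_scaleR_left[of "\<psi> t"]] F[OF st(2)]
        by (simp add: o_def)
      moreover have "integral {s..t} (\<lambda>\<tau>. F s *\<^sub>R \<psi>' \<tau>) = F s *\<^sub>R (\<psi> t - \<psi> s)"
        using d\<psi> by simp
      moreover have "F t *\<^sub>R \<psi> t - F s *\<^sub>R \<psi> s = (F t - F s) *\<^sub>R \<psi> t + F s *\<^sub>R (\<psi> t - \<psi> s)"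
        by (simp add: algebra_simps)
      ultimately show ?thesis by metis
    qed
    also have "integral {s..t} (\<lambda>\<tau>. p \<tau> *\<^sub>R \<psi> \<tau>) + integral {s..t} (\<lambda>\<tau>. F \<tau> *\<^sub>R \<psi>' \<tau>)
        - (integral {s..t} (\<lambda>\<tau>. p \<tau> *\<^sub>R \<psi> t) + integral {s..t} (\<lambda>\<tau>. F s *\<^sub>R \<psi>' \<tau>))
      = integral {s..t} (\<lambda>\<tau>. p \<tau> *\<^sub>R (\<psi> \<tau> - \<psi> t)) + integral {s..t} (\<lambda>\<tau>. (F \<tau> - F s) *\<^sub>R \<psi>' \<tau>)"
    proof -
      have "continuous_on UNIV (\<lambda>\<tau>. F s *\<^sub>R \<psi>' \<tau>)" by (intro continuous_intros cont\<psi>')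
      then show ?thesis
        unfolding scaleR_diff_right scaleR_diff_left
        using i1[OF cont\<psi>, of s t] i1[of "\<lambda>_. \<psi> t" s t] i2[OF contF\<psi>', of s t] i2[of "\<lambda>\<tau>. F s *\<^sub>R \<psi>' \<tau>" s t]
        by (simp add: Henstock_Kurzweil_Integration.integral_diff)
    qed
    finally have eq: "N t - N s = integral {s..t} (\<lambda>\<tau>. p \<tau> *\<^sub>R (\<psi> \<tau> - \<psi> t))
      + integral {s..t} (\<lambda>\<tau>. (F \<tau> - F s) *\<^sub>R \<psi>' \<tau>)" .
    have "norm (integral {s..t} (\<lambda>\<tau>. p \<tau> *\<^sub>R (\<psi> \<tau> - \<psi> t))) \<le> integral {s..t} (\<lambda>\<tau>. (B * (t - s)) * \<bar>p \<tau>\<bar>)"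
    proof (rule integral_norm_bound_integral)
      show "(\<lambda>\<tau>. p \<tau> *\<^sub>R (\<psi> \<tau> - \<psi> t)) integrable_on {s..t}"
        by (rule i1) (intro continuous_intros cont\<psi>)
      show "(\<lambda>\<tau>. (B * (t - s)) * \<bar>p \<tau>\<bar>) integrable_on {s..t}"
        using ip by (intro integrable_on_mult_right)
      show "norm (p \<tau> *\<^sub>R (\<psi> \<tau> - \<psi> t)) \<le> B * (t - s) * \<bar>p \<tau>\<bar>" if \<tau>: "\<tau> \<in> {s..t}" for \<tau>
      proof -
        have "norm (\<psi> \<tau> - \<psi> t) \<le> B * norm (\<tau> - t)"
        proof (rule differentiable_bound[where S = "{\<tau>..t}" and f' = "\<lambda>x c. c *\<^sub>R \<psi>' x"])
          show "(\<psi> has_derivative (\<lambda>c. c *\<^sub>R \<psi>' x)) (at x within {\<tau>..t})" for x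
            using \<psi>[of x] has_derivative_at_withinI unfolding has_vector_derivative_def by blast
          show "onorm (\<lambda>c. c *\<^sub>R \<psi>' x) \<le> B" if "x \<in> {\<tau>..t}" for x
          proof (rule onorm_bound)
            show "norm (c *\<^sub>R \<psi>' x) \<le> B * norm c" for c
              using mult_left_mono[OF B(2)[of x] abs_ge_zero[of c]] that \<tau> st by (simp add: mult.commute)
          qed (use B(1) in simp)
        qed (use \<tau> in auto)
        also have "\<dots> \<le> B * (t - s)" using \<tau> B(1) by (intro mult_left_mono) auto
        finally have "\<bar>p \<tau>\<bar> * norm (\<psi> \<tau> - \<psi> t) \<le> \<bar>p \<tau>\<bar> * (B * (t - s))"
          by (rule mult_left_mono) simp
        then show ?thesis by (simp add: mult.commute)
      qed
    qed
    also have "\<dots> = B * (t - s) * (P t - P s)"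
      by (simp add: P)
    finally have le1: "norm (integral {s..t} (\<lambda>\<tau>. p \<tau> *\<^sub>R (\<psi> \<tau> - \<psi> t))) \<le> B * (t - s) * (P t - P s)" .
    have le2: "norm (integral {s..t} (\<lambda>\<tau>. (F \<tau> - F s) *\<^sub>R \<psi>' \<tau>)) \<le> ((P t - P s) * B) * (t - s)"
    proof (rule integral_bound[OF st(2)])
      show "continuous_on {s..t} (\<lambda>\<tau>. (F \<tau> - F s) *\<^sub>R \<psi>' \<tau>)"
        by (rule continuous_on_subset[of UNIV]) (auto intro!: continuous_intros contF cont\<psi>')
      show "norm ((F \<tau> - F s) *\<^sub>R \<psi>' \<tau>) \<le> (P t - P s) * B" if \<tau>: "\<tau> \<in> {s..t}" for \<tau>
      proof -
        have "\<bar>F \<tau> - F s\<bar> = norm (integral {s..\<tau>} p)" using F \<tau> by simp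
        also have "\<dots> \<le> integral {s..\<tau>} (\<lambda>\<tau>. \<bar>p \<tau>\<bar>)"
          using ip by (intro integral_norm_bound_integral) auto
        also have "\<dots> \<le> P t - P s"
          unfolding P using \<tau> ip by (intro integral_subset_le) auto
        finally show ?thesis
          using B(2)[of \<tau>] \<tau> st by (auto intro: mult_mono)
      qed
    qed
    show ?thesis
      unfolding eq using norm_triangle_mono[OF le1 le2] by (simp add: algebra_simps)
  qed
  then have "N T = N 0"
    by (rule eq_if_increments_le_mult) (use \<open>T \<ge> 0\<close> in auto)
  then show "integral {0..T} (\<lambda>t. p t *\<^sub>R \<psi> t) = F T *\<^sub>R \<psi> T - F 0 *\<^sub>R \<psi> 0 - integral {0..T} (\<lambda>t. F t *\<^sub>R \<psi>' t)"
    by (simp add: N_def algebra_simps)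
qed

lemma indefinite_integral_exists:
  fixes p :: "real \<Rightarrow> real"
  assumes int: "\<And>a b. p integrable_on {a..b}"
  shows "\<exists>P. continuous_on UNIV P \<and> (\<forall>s t. s \<le> t \<longrightarrow> P t - P s = integral {s..t} p)"
proof -
  define P where "P t = (if 0 \<le> t then integral {0..t} p else - integral {t..0} p)" for t
  have P: "P t - P s = integral {s..t} p" if "s \<le> t" for s t
    using Henstock_Kurzweil_Integration.integral_combine[of 0 s t p]
      Henstock_Kurzweil_Integration.integral_combine[of s 0 t p]
      Henstock_Kurzweil_Integration.integral_combine[of s t 0 p] int that
    by (cases "0 \<le> s"; cases "0 \<le> t") (auto simp: P_def)
  have "isCont P t" for t
  proof -
    have "continuous_on {t-1..t+1} (\<lambda>x. integral {t-1..x} p + P (t - 1))"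
      by (intro continuous_intros indefinite_integral_continuous_1 int)
    then have "continuous_on {t-1..t+1} P"
      by (rule continuous_on_eq) (use P in \<open>auto simp flip: P\<close>)
    then show ?thesis
      by (rule continuous_on_interior) simp
  qed
  then have "continuous_on UNIV P" by (simp add: continuous_at_imp_continuous_on)
  with P show ?thesis by blast
qed

lemma quasiperiodic_exp_growth:
  fixes P :: "real \<Rightarrow> real"
  assumes cont: "continuous_on UNIV P" and "L > 0"
    and shift: "\<And>t. P (t + L) = P t + c"
  shows "\<exists>C. \<forall>t. \<bar>P t\<bar> \<le> C * exp \<bar>t\<bar>"
proof -
  have "bounded (P ` {- L..L})"
    by (intro compact_imp_bounded compact_continuous_image continuous_on_subset[OF cont]) auto
  then obtain B where B: "B > 0" "\<And>t. \<bar>t\<bar> \<le> L \<Longrightarrow> \<bar>P t\<bar> \<le> B"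
    unfolding bounded_pos by (auto simp: abs_le_iff)
  have growth: "\<bar>P t\<bar> \<le> B + real n * \<bar>c\<bar>" if "\<bar>t\<bar> \<le> L * real (Suc n)" for n t
    using that
  proof (induction n arbitrary: t)
    case 0
    then show ?case using B(2) by simp
  next
    case (Suc n)
    consider "\<bar>t\<bar> \<le> L" | "t > L" | "t < - L" by linarith
    then show ?case
    proof cases
      case 1
      moreover have "0 \<le> real (Suc n) * \<bar>c\<bar>" by simp
      ultimately show ?thesis using B(2)[of t] by linarith
    next
      case 2
      then have "\<bar>t - L\<bar> \<le> L * real (Suc n)" using Suc.prems by (simp add: algebra_simps)
      from Suc.IH[OF this] shift[of "t - L"] show ?thesis by (simp add: algebra_simps)
    next
      case 3
      then have "\<bar>t + L\<bar> \<le> L * real (Suc n)" using Suc.prems by (simp add: algebra_simps)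
      from Suc.IH[OF this] shift[of t] show ?thesis by (simp add: algebra_simps)
    qed
  qed
  show ?thesis
  proof (intro exI[of _ "B + \<bar>c\<bar> / L"] allI)
    fix t
    define n where "n = nat \<lfloor>\<bar>t\<bar> / L\<rfloor>"
    have n: "real n \<le> \<bar>t\<bar> / L" "\<bar>t\<bar> / L \<le> real (Suc n)"
      using \<open>L > 0\<close> unfolding n_def by (auto simp: of_nat_nat) linarith
    have "\<bar>P t\<bar> \<le> B + real n * \<bar>c\<bar>"
      using growth n(2) \<open>L > 0\<close> by (simp add: pos_divide_le_eq mult.commute)
    also have "\<dots> \<le> B + (\<bar>t\<bar> / L) * \<bar>c\<bar>"
      using n(1) by (intro add_left_mono mult_right_mono) auto
    also have "\<dots> = B * 1 + (\<bar>c\<bar> / L) * \<bar>t\<bar>" by simp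
    also have "\<dots> \<le> B * exp \<bar>t\<bar> + (\<bar>c\<bar> / L) * exp \<bar>t\<bar>"
    proof -
      have "\<bar>t\<bar> \<le> exp \<bar>t\<bar>" using exp_ge_add_one_self[of "\<bar>t\<bar>"] by linarith
      then show ?thesis using B(1) \<open>L > 0\<close> by (intro add_mono mult_left_mono) auto
    qed
    finally show "\<bar>P t\<bar> \<le> (B + \<bar>c\<bar> / L) * exp \<bar>t\<bar>" by (simp add: distrib_right)
  qed
qed

lemma caratheodory_solution2_of_system:
  fixes f p P v y :: "real \<Rightarrow> real"
  assumes contf: "continuous_on UNIV f"
    and int: "\<And>a b. p absolutely_integrable_on {a..b}"
    and P: "\<And>s t. s \<le> t \<Longrightarrow> P t - P s = integral {s..t} p"
    and y: "\<And>t. (y has_vector_derivative v t + \<epsilon> * (P (t - \<theta>) - P (- \<theta>))) (at t)"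
      "\<And>t. (v has_vector_derivative - f (y t)) (at t)"
  shows "caratheodory_solution2 (\<lambda>t x. \<epsilon> * p t - f x) (\<lambda>t. y (t + \<theta>))"
proof -
  define \<omega> where "\<omega> t = v (t + \<theta>) + \<epsilon> * (P t - P (- \<theta>))" for t
  define g where "g t = \<epsilon> * p t - f (y (t + \<theta>))" for t
  have dx: "((\<lambda>t. y (t + \<theta>)) has_vector_derivative \<omega> t) (at t)" for t
    using has_vector_derivative_shift[OF y(1)[of "t + \<theta>"]] by (simp add: \<omega>_def)
  have dv: "((\<lambda>t. v (t + \<theta>)) has_vector_derivative - f (y (t + \<theta>))) (at t)" for t
    by (rule has_vector_derivative_shift[OF y(2)])
  have "continuous_on UNIV (\<lambda>t. y (t + \<theta>))"
    using dx by (meson continuous_at_imp_continuous_on has_vector_derivative_continuous)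
  then have contfy: "continuous_on UNIV (\<lambda>t. - f (y (t + \<theta>)))"
    by (intro continuous_intros continuous_on_compose2[OF contf]) auto
  have absfy: "(\<lambda>t. - f (y (t + \<theta>))) absolutely_integrable_on {a..b}" for a b
    by (rule absolutely_integrable_continuous_real) (rule continuous_on_subset[OF contfy], simp)
  have absp: "(\<lambda>t. \<epsilon> * p t) absolutely_integrable_on {a..b}" for a b
    using int by (intro set_integrable_mult_right)
  have absg: "g absolutely_integrable_on {a..b}" for a b
    using set_integral_add(1)[OF absp absfy] by (simp add: g_def[abs_def])
  have ip: "p integrable_on {a..b}" "(\<lambda>t. - f (y (t + \<theta>))) integrable_on {a..b}" for a b
    using int absfy set_lebesgue_integral_eq_integral(1) by blast+
  have \<omega>: "\<omega> t - \<omega> s = integral {s..t} g" if "s \<le> t" for s t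
  proof -
    have "integral {s..t} (\<lambda>t. - f (y (t + \<theta>))) = v (t + \<theta>) - v (s + \<theta>)"
      using fundamental_theorem_of_calculus[OF that, of "\<lambda>t. v (t + \<theta>)"] dv
      by (metis has_vector_derivative_at_within integral_unique)
    moreover have "integral {s..t} (\<lambda>t. \<epsilon> * p t + - f (y (t + \<theta>)))
        = \<epsilon> * integral {s..t} p + integral {s..t} (\<lambda>t. - f (y (t + \<theta>)))"
      using ip[of s t] by (subst Henstock_Kurzweil_Integration.integral_add) (auto intro: integrable_on_mult_right)
    ultimately show ?thesis
      using P[OF that] by (simp add: \<omega>_def g_def[abs_def] algebra_simps)
  qed
  have "AE t in lebesgue. (\<omega> has_real_derivative g t) (at t)"
    by (rule AE_has_derivative_indefinite_integral[OF set_lebesgue_integral_eq_integral(1)[OF absg] \<omega>])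
  moreover have "absolutely_continuous_on_interval a b \<omega>" for a b
    by (rule absolutely_continuous_indefinite_integral[OF absg \<omega>])
  ultimately show ?thesis
    unfolding caratheodory_solution2_def
    using dx by (intro exI[of _ \<omega>]) (auto simp: g_def has_real_derivative_iff_has_vector_derivative)
qed

section \<open>Brouwer degree\<close>

lemma real_polynomial_function_gradient:
  fixes f :: "'a::euclidean_space \<Rightarrow> real"
  assumes "real_polynomial_function f"
  shows "\<exists>G. continuous_on UNIV G \<and> (\<forall>x. (f has_derivative (\<lambda>h. G x \<bullet> h)) (at x))"
  using assms
proof induction
  case (linear f)
  have "f = (\<lambda>h. (\<Sum>b\<in>Basis. f b *\<^sub>R b) \<bullet> h)"
  proof
    fix h
    note lin = linear.hyps[THEN bounded_linear.linear]
    have "f h = f (\<Sum>b\<in>Basis. (h \<bullet> b) *\<^sub>R b)"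
      by (simp add: euclidean_representation)
    also have "\<dots> = (\<Sum>b\<in>Basis. (h \<bullet> b) * f b)"
      by (simp add: linear_sum[OF lin] linear_scale[OF lin])
    finally have "f h = (\<Sum>b\<in>Basis. (h \<bullet> b) * f b)" .
    then show "f h = (\<Sum>b\<in>Basis. f b *\<^sub>R b) \<bullet> h"
      by (simp add: inner_sum_left inner_commute[of h] mult.commute)
  qed
  with bounded_linear_imp_has_derivative[OF linear.hyps]
  have "(f has_derivative (\<lambda>h. (\<Sum>b\<in>Basis. f b *\<^sub>R b) \<bullet> h)) (at x)" for x
    by metis
  then show ?case
    by (intro exI[of _ "\<lambda>x. \<Sum>b\<in>Basis. f b *\<^sub>R b"]) (auto intro: continuous_intros)
next
  case (const c)
  show ?case by (rule exI[of _ "\<lambda>x. 0"]) (auto intro: continuous_intros)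
next
  case (add f g)
  then obtain F G where "continuous_on UNIV F" "continuous_on UNIV G"
    "\<And>x. (f has_derivative (\<lambda>h. F x \<bullet> h)) (at x)" "\<And>x. (g has_derivative (\<lambda>h. G x \<bullet> h)) (at x)"
    by blast
  then show ?case
    by (intro exI[of _ "\<lambda>x. F x + G x"])
      (auto intro!: continuous_intros derivative_eq_intros simp: inner_add_left)
next
  case (mult f g)
  then obtain F G where FG: "continuous_on UNIV F" "continuous_on UNIV G"
    "\<And>x. (f has_derivative (\<lambda>h. F x \<bullet> h)) (at x)" "\<And>x. (g has_derivative (\<lambda>h. G x \<bullet> h)) (at x)"
    by blast
  have "continuous_on UNIV f" "continuous_on UNIV g"
    by (auto intro!: continuous_at_imp_continuous_on
        has_derivative_continuous[OF FG(3)] has_derivative_continuous[OF FG(4)])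
  then have "continuous_on UNIV (\<lambda>x. f x *\<^sub>R G x + g x *\<^sub>R F x)"
    by (intro continuous_intros FG)
  moreover have "((\<lambda>x. f x * g x) has_derivative (\<lambda>h. (f x *\<^sub>R G x + g x *\<^sub>R F x) \<bullet> h)) (at x)" for x
    using has_derivative_mult[OF FG(3)[of x] FG(4)[of x]]
    by (simp add: inner_add_left mult.commute)
  ultimately show ?case by blast
qed

lemma polynomial_function_jacobian:
  fixes g :: "real^'n \<Rightarrow> real^'m"
  assumes "polynomial_function g"
  shows "\<exists>Dg. continuous_on UNIV Dg \<and> (\<forall>x. (g has_derivative (\<lambda>h. Dg x *v h)) (at x))"
proof -
  have "real_polynomial_function (\<lambda>x. g x $ i)" for i
    using assms bounded_linear_vec_nth[of i] by (auto simp: polynomial_function_def o_def)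
  then have "\<forall>i. \<exists>G. continuous_on UNIV G \<and> (\<forall>x. ((\<lambda>x. g x $ i) has_derivative (\<lambda>h. G x \<bullet> h)) (at x))"
    using real_polynomial_function_gradient by blast
  from choice[OF this] obtain G where G: "\<And>i. continuous_on UNIV (G i)"
    "\<And>i x. ((\<lambda>x. g x $ i) has_derivative (\<lambda>h. G i x \<bullet> h)) (at x)"
    by blast
  have "(g has_derivative (\<lambda>h. (\<chi> i. G i x) *v h)) (at x)" for x
    unfolding has_derivative_componentwise_within[of g]
  proof
    fix b :: "real^'m" assume "b \<in> Basis"
    then obtain i where b: "b = axis i 1" by (auto simp: Basis_vec_def)
    show "((\<lambda>x. g x \<bullet> b) has_derivative (\<lambda>h. ((\<chi> i. G i x) *v h) \<bullet> b)) (at x)"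
      using G(2)[of i x]
      by (simp add: b inner_axis matrix_vector_mul_component)
  qed
  then show ?thesis
    using G(1) by (intro exI[of _ "\<lambda>x. \<chi> i. G i x"]) (auto intro!: continuous_intros)
qed

text \<open>If \<open>h\<close> had no zero, neither would a sufficiently good polynomial approximation, and the sum
  defining the degree would be empty.\<close>

lemma brouwer_degree_nonzero_imp_solution:
  fixes f h :: "real^'n \<Rightarrow> real^'n"
  assumes deg: "brouwer_degree f U y \<noteq> 0"
    and conth: "continuous_on (closure U) h"
    and close: "\<And>x. x \<in> closure U \<Longrightarrow> dist (h x) (f x) < infdist y (f ` frontier U)"
  shows "\<exists>x\<in>closure U. h x = y"
proof (rule ccontr)
  assume no: "\<not> (\<exists>x\<in>closure U. h x = y)"
  define is_deg where "is_deg d \<longleftrightarrow> (\<forall>g Dg. regular_approximation f U y g Dg \<longrightarrow>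
                      of_int d = (\<Sum>x\<in>{x\<in>U. g x = y}. sgn (det (Dg x))))" for d :: int
  have bd: "bounded U" and contf: "continuous_on (closure U) f" and ex1: "\<exists>!d. is_deg d"
    and nz: "(THE d. is_deg d) \<noteq> 0"
    using deg unfolding brouwer_degree_def is_deg_def[abs_def] Let_def by (auto split: if_splits)
  have isd: "is_deg (THE d. is_deg d)"
    using ex1 by (rule theI')
  have cpt: "compact (closure U)" using bd by simp
  have pos: "\<exists>\<delta>>0. \<forall>x\<in>closure U. \<delta> \<le> k x"
    if "continuous_on (closure U) k" "\<And>x. x \<in> closure U \<Longrightarrow> k x > 0" for k :: "real^'n \<Rightarrow> real"
  proof (cases "closure U = {}")
    case True
    then show ?thesis by (intro exI[of _ 1]) auto
  next
    case False
    with continuous_attains_inf[OF cpt _ that(1)] that(2) show ?thesis by blast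
  qed
  obtain \<delta>1 where \<delta>1: "\<delta>1 > 0" "\<And>x. x \<in> closure U \<Longrightarrow> \<delta>1 \<le> dist (h x) y"
    using pos[OF continuous_on_dist[OF conth continuous_on_const[of _ y]]] no by auto
  obtain \<delta>2 where \<delta>2: "\<delta>2 > 0"
    "\<And>x. x \<in> closure U \<Longrightarrow> \<delta>2 \<le> infdist y (f ` frontier U) - dist (h x) (f x)"
    using pos[OF continuous_on_diff[OF continuous_on_const[of _ "infdist y (f ` frontier U)"]
          continuous_on_dist[OF conth contf]]] close by auto
  obtain g where g: "polynomial_function g"
    and gh: "\<And>x. x \<in> closure U \<Longrightarrow> norm (h x - g x) < min \<delta>1 \<delta>2"
    using Stone_Weierstrass_polynomial_function[OF cpt conth, of "min \<delta>1 \<delta>2"] \<delta>1(1) \<delta>2(1)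
    by auto
  have gy: "g x \<noteq> y" if "x \<in> U" for x
    using gh[of x] \<delta>1(2)[of x] that closure_subset by (fastforce simp: dist_norm)
  obtain Dg where Dg: "continuous_on UNIV Dg" "\<And>x. (g has_derivative (\<lambda>h. Dg x *v h)) (at x)"
    using polynomial_function_jacobian[OF g] by blast
  have "regular_approximation f U y g Dg"
    unfolding regular_approximation_def
  proof (intro conjI ballI impI)
    show "continuous_on (closure U) g"
      by (rule continuous_on_polymonial_function[OF g])
    show "continuous_on U Dg"
      using Dg(1) continuous_on_subset by blast
    show "dist (g x) (f x) < infdist y (f ` frontier U)" if "x \<in> closure U" for x
      using gh[OF that] \<delta>2(2)[OF that] dist_triangle[of "g x" "f x" "h x"]
      by (simp add: dist_norm norm_minus_commute)
  qed (use Dg gy in auto)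
  moreover have "{x\<in>U. g x = y} = {}" using gy by auto
  ultimately have "of_int (THE d. is_deg d) = (0::real)"
    using isd unfolding is_deg_def by (metis (no_types, lifting) sum.empty)
  with nz show False by simp
qed

section \<open>Perturbation of the free equation\<close>

lemma derivative_bounded_imp_lipschitz:
  fixes f f' :: "real \<Rightarrow> real"
  assumes "\<And>x. (f has_real_derivative f' x) (at x)" and "\<And>x. \<bar>f' x\<bar> \<le> M"
  shows "\<bar>f a - f b\<bar> \<le> M * \<bar>a - b\<bar>"
  using field_differentiable_bound[of UNIV f f' M a b] assms by auto

lemma linearization_error_le:
  fixes f f' :: "real \<Rightarrow> real"
  assumes f: "\<And>x. (f has_real_derivative f' x) (at x)"
    and close: "\<And>x. \<bar>x - a\<bar> \<le> \<bar>b - a\<bar> \<Longrightarrow> \<bar>f' x - f' a\<bar> \<le> \<kappa>"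
  shows "\<bar>f' a * (b - a) - (f b - f a)\<bar> \<le> \<kappa> * \<bar>b - a\<bar>"
proof -
  have "norm ((f' a * b - f b) - (f' a * a - f a)) \<le> \<kappa> * norm (b - a)"
  proof (rule field_differentiable_bound[where S = "closed_segment a b" and f' = "\<lambda>x. f' a - f' x"])
    show "((\<lambda>x. f' a * x - f x) has_field_derivative f' a - f' x) (at x within closed_segment a b)" for x
      by (auto intro!: derivative_eq_intros DERIV_subset[OF f])
    show "norm (f' a - f' x) \<le> \<kappa>" if "x \<in> closed_segment a b" for x
      using close[of x] that by (auto simp: closed_segment_eq_real_ivl abs_minus_commute split: if_splits)
  qed auto
  then show ?thesis by (simp add: algebra_simps)
qed

text \<open>Lagrange's identity: \<open>S = (v - w) \<psi> - (y - \<phi>) \<xi> + \<epsilon> \<integral> q \<xi>\<close> has derivative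
  \<open>(V''(\<phi>) (y - \<phi>) - (V'(y) - V'(\<phi>))) \<psi>\<close>, which is small compared with \<open>y - \<phi>\<close>.\<close>

lemma lagrange_identity_remainder:
  fixes \<phi> w y v q :: "real \<Rightarrow> real" and \<psi> \<xi> :: "real \<Rightarrow> 'a::euclidean_space"
  assumes \<phi>: "\<And>t. (\<phi> has_vector_derivative w t) (at t)" "\<And>t. (w has_vector_derivative - f (\<phi> t)) (at t)"
    and y: "\<And>t. (y has_vector_derivative v t + \<epsilon> * q t) (at t)" "\<And>t. (v has_vector_derivative - f (y t)) (at t)"
    and init: "y 0 = \<phi> 0" "v 0 = w 0"
    and \<psi>: "\<And>t. (\<psi> has_vector_derivative \<xi> t) (at t)"
      "\<And>t. (\<xi> has_vector_derivative - (f' (\<phi> t) *\<^sub>R \<psi> t)) (at t)"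
    and contq: "continuous_on UNIV q" and "T > 0"
    and small: "\<And>t. 0 < t \<Longrightarrow> t < T \<Longrightarrow>
      \<bar>f' (\<phi> t) * (y t - \<phi> t) - (f (y t) - f (\<phi> t))\<bar> * norm (\<psi> t) \<le> C"
  shows "norm (((v T + \<epsilon> * q T - w T) *\<^sub>R \<psi> T - (y T - \<phi> T) *\<^sub>R \<xi> T)
    - \<epsilon> *\<^sub>R (q T *\<^sub>R \<psi> T - integral {0..T} (\<lambda>t. q t *\<^sub>R \<xi> t))) \<le> T * C"
proof -
  have "continuous_on UNIV \<xi>"
    using \<psi>(2) by (meson continuous_at_imp_continuous_on has_vector_derivative_continuous)
  then have "continuous_on UNIV (\<lambda>t. q t *\<^sub>R \<xi> t)"
    by (intro continuous_intros contq)
  then obtain A where A: "A 0 = 0" "\<And>t. (A has_vector_derivative q t *\<^sub>R \<xi> t) (at t)"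
    using antiderivative_exists by blast
  have AT: "A T = integral {0..T} (\<lambda>t. q t *\<^sub>R \<xi> t)"
    using fundamental_theorem_of_calculus[of 0 T A "\<lambda>t. q t *\<^sub>R \<xi> t"] A \<open>T > 0\<close>
    by (metis diff_zero has_vector_derivative_at_within integral_unique less_imp_le)
  define S where "S t = (v t - w t) *\<^sub>R \<psi> t - (y t - \<phi> t) *\<^sub>R \<xi> t + \<epsilon> *\<^sub>R A t" for t
  define S' where "S' t = (f' (\<phi> t) * (y t - \<phi> t) - (f (y t) - f (\<phi> t))) *\<^sub>R \<psi> t" for t
  note real = \<phi>[folded has_real_derivative_iff_has_vector_derivative]
    y[folded has_real_derivative_iff_has_vector_derivative]
  have dS: "(S has_vector_derivative S' t) (at t)" for t
  proof -
    have "(S has_vector_derivative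
        ((v t - w t) *\<^sub>R \<xi> t + (- f (y t) - - f (\<phi> t)) *\<^sub>R \<psi> t)
        - ((y t - \<phi> t) *\<^sub>R (- (f' (\<phi> t) *\<^sub>R \<psi> t)) + (v t + \<epsilon> * q t - w t) *\<^sub>R \<xi> t)
        + \<epsilon> *\<^sub>R (q t *\<^sub>R \<xi> t)) (at t)"
      unfolding S_def[abs_def]
      by (intro has_vector_derivative_add has_vector_derivative_diff has_vector_derivative_scaleR
          bounded_linear.has_vector_derivative[OF bounded_linear_scaleR_right] DERIV_diff real \<psi> A)
    also have "((v t - w t) *\<^sub>R \<xi> t + (- f (y t) - - f (\<phi> t)) *\<^sub>R \<psi> t)
        - ((y t - \<phi> t) *\<^sub>R (- (f' (\<phi> t) *\<^sub>R \<psi> t)) + (v t + \<epsilon> * q t - w t) *\<^sub>R \<xi> t)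
        + \<epsilon> *\<^sub>R (q t *\<^sub>R \<xi> t) = S' t"
      by (simp add: S'_def algebra_simps)
    finally show ?thesis .
  qed
  have "norm (S T - S 0) \<le> C * T - C * 0"
  proof (rule differentiable_bound_general[where f' = S' and \<phi>' = "\<lambda>_. C"])
    show "continuous_on {0..T} S"
      using dS by (meson continuous_at_imp_continuous_on has_vector_derivative_continuous)
    show "((\<lambda>t. C * t) has_vector_derivative C) (at x)" for x
      by (auto intro!: derivative_eq_intros simp flip: has_real_derivative_iff_has_vector_derivative)
    show "norm (S' t) \<le> C" if "0 < t" "t < T" for t
      using small[OF that] by (simp add: S'_def)
  qed (use \<open>T > 0\<close> dS in \<open>auto intro!: continuous_intros\<close>)
  moreover have "S 0 = 0" by (simp add: S_def init A)
  moreover have "S T = ((v T + \<epsilon> * q T - w T) *\<^sub>R \<psi> T - (y T - \<phi> T) *\<^sub>R \<xi> T)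
    - \<epsilon> *\<^sub>R (q T *\<^sub>R \<psi> T - integral {0..T} (\<lambda>t. q t *\<^sub>R \<xi> t))"
    by (simp add: S_def AT algebra_simps)
  ultimately show ?thesis by (simp add: mult.commute)
qed

lemma forced_solution_dist_le:
  fixes \<phi> w y v q :: "real \<Rightarrow> real"
  assumes \<phi>: "\<And>t. (\<phi> has_vector_derivative w t) (at t)" "\<And>t. (w has_vector_derivative - f (\<phi> t)) (at t)"
    and y: "\<And>t. (y has_vector_derivative v t + \<epsilon> * q t) (at t)" "\<And>t. (v has_vector_derivative - f (y t)) (at t)"
    and init: "y 0 = \<phi> 0" "v 0 = w 0"
    and lip: "\<And>a b. \<bar>f a - f b\<bar> \<le> M * \<bar>a - b\<bar>" "M \<ge> 0"
    and q: "\<And>t. 0 \<le> t \<Longrightarrow> t \<le> T \<Longrightarrow> \<bar>q t\<bar> \<le> B" and t: "0 \<le> t" "t \<le> T"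
  shows "\<bar>y t - \<phi> t\<bar> \<le> 2 * B * T * exp (2 * (1 + M) * T) * \<bar>\<epsilon>\<bar>"
proof -
  have B: "B \<ge> 0" using q[OF t] by linarith
  have "norm ((y t - \<phi> t, v t - w t))
      \<le> 2 * (norm ((y 0 - \<phi> 0, v 0 - w 0)) + (B * \<bar>\<epsilon>\<bar>) * T) * exp (2 * (1 + M) * T)"
  proof (rule gronwall[where w' = "\<lambda>t. (v t + \<epsilon> * q t - w t, - f (y t) - - f (\<phi> t))"])
    show "((\<lambda>t. (y t - \<phi> t, v t - w t)) has_vector_derivative
        (v t + \<epsilon> * q t - w t, - f (y t) - - f (\<phi> t))) (at t)" for t
      by (intro has_vector_derivative_Pair has_vector_derivative_diff \<phi> y)
    show "norm (v s + \<epsilon> * q s - w s, - f (y s) - - f (\<phi> s))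
        \<le> (1 + M) * norm (y s - \<phi> s, v s - w s) + B * \<bar>\<epsilon>\<bar>" if s: "0 \<le> s" "s \<le> T" for s
    proof -
      have "norm (v s + \<epsilon> * q s - w s, - f (y s) - - f (\<phi> s))
          \<le> \<bar>v s + \<epsilon> * q s - w s\<bar> + \<bar>- f (y s) - - f (\<phi> s)\<bar>"
        using norm_Pair_le by (metis real_norm_def)
      moreover have "\<bar>\<epsilon> * q s\<bar> \<le> B * \<bar>\<epsilon>\<bar>"
        using mult_right_mono[OF q[OF s] abs_ge_zero[of \<epsilon>]] by (simp add: abs_mult mult.commute)
      moreover have "\<bar>- f (y s) - - f (\<phi> s)\<bar> \<le> M * \<bar>y s - \<phi> s\<bar>"
        using lip(1)[of "y s" "\<phi> s"] by linarith
      moreover have "M * \<bar>y s - \<phi> s\<bar> \<le> M * norm (y s - \<phi> s, v s - w s)"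
        using norm_fst_le[of "y s - \<phi> s" "v s - w s"] lip(2) by (intro mult_left_mono) auto
      moreover have "\<bar>v s - w s\<bar> \<le> norm (y s - \<phi> s, v s - w s)"
        using norm_snd_le[of "v s - w s" "y s - \<phi> s"] by simp
      ultimately show ?thesis by (simp add: distrib_right)
    qed
  qed (use t lip(2) B in auto)
  moreover have "\<bar>y t - \<phi> t\<bar> \<le> norm (y t - \<phi> t, v t - w t)"
    using norm_fst_le[of "y t - \<phi> t" "v t - w t"] by simp
  moreover have "norm ((y 0 - \<phi> 0, v 0 - w 0)) = 0" by (simp add: init)
  ultimately show ?thesis by (simp add: mult_ac)
qed

lemma variational_wronskian:
  fixes \<psi> \<xi> :: "real \<Rightarrow> complex"
  assumes \<psi>: "\<And>t. (\<psi> has_vector_derivative \<xi> t) (at t)"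
      "\<And>t. (\<xi> has_vector_derivative - (a t *\<^sub>R \<psi> t)) (at t)"
    and init: "\<psi> 0 = 1" "\<xi> 0 = \<i>"
  shows "Re (\<psi> t) * Im (\<xi> t) - Im (\<psi> t) * Re (\<xi> t) = 1"
proof -
  note re = bounded_linear.has_vector_derivative[OF bounded_linear_Re, folded has_real_derivative_iff_has_vector_derivative]
  note im = bounded_linear.has_vector_derivative[OF bounded_linear_Im, folded has_real_derivative_iff_has_vector_derivative]
  have "((\<lambda>t. Re (\<psi> t) * Im (\<xi> t) - Im (\<psi> t) * Re (\<xi> t)) has_real_derivative 0) (at t)" for t
    by (rule DERIV_cong, rule DERIV_diff[OF DERIV_mult[OF re[OF \<psi>(1)] im[OF \<psi>(2)]]
            DERIV_mult[OF im[OF \<psi>(1)] re[OF \<psi>(2)]]]) simp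
  then have "Re (\<psi> t) * Im (\<xi> t) - Im (\<psi> t) * Re (\<xi> t) = Re (\<psi> 0) * Im (\<xi> 0) - Im (\<psi> 0) * Re (\<xi> 0)"
    using DERIV_isconst_all by blast
  then show ?thesis by (simp add: init)
qed

lemma scaleR_diff_eq_0_wronskian:
  fixes \<psi> \<xi> :: complex
  assumes "Re \<psi> * Im \<xi> - Im \<psi> * Re \<xi> = 1" and "a *\<^sub>R \<psi> - d *\<^sub>R \<xi> = 0"
  shows "a = 0" "d = 0"
proof -
  have e: "a * Re \<psi> = d * Re \<xi>" "a * Im \<psi> = d * Im \<xi>"
    using assms(2) by (auto simp: complex_eq_iff)
  have "a = a * (Re \<psi> * Im \<xi> - Im \<psi> * Re \<xi>)" using assms(1) by simp
  also have "\<dots> = (a * Re \<psi>) * Im \<xi> - (a * Im \<psi>) * Re \<xi>" by (simp add: algebra_simps)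
  finally show "a = 0" using e by simp
  have "d = d * (Re \<psi> * Im \<xi> - Im \<psi> * Re \<xi>)" using assms(1) by simp
  also have "\<dots> = Re \<psi> * (d * Im \<xi>) - Im \<psi> * (d * Re \<xi>)" by (simp add: algebra_simps)
  also have "\<dots> = Re \<psi> * (a * Im \<psi>) - Im \<psi> * (a * Re \<psi>)" by (simp only: e)
  also have "\<dots> = 0" by (simp add: algebra_simps)
  finally show "d = 0" .
qed

lemma forced_solution_periodic:
  fixes f P v y :: "real \<Rightarrow> real"
  assumes lip: "\<And>a b. \<bar>f a - f b\<bar> \<le> M * \<bar>a - b\<bar>" "M \<ge> 0"
    and shift: "\<And>t. P (t + L) = P t + c"
    and y: "\<And>t. (y has_vector_derivative v t + \<epsilon> * (P (t - \<theta>) - P (- \<theta>))) (at t)"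
      "\<And>t. (v has_vector_derivative - f (y t)) (at t)"
    and return: "y L = y 0" "v L + \<epsilon> * (P (L - \<theta>) - P (- \<theta>)) = v 0"
  shows "y (t + L) = y t"
proof -
  define q where "q t = \<epsilon> * (P (t - \<theta>) - P (- \<theta>))" for t
  have q: "q (t + L) = q t + \<epsilon> * c" for t
    using shift[of "t - \<theta>"] by (simp add: q_def algebra_simps)
  have q0: "q 0 = 0" by (simp add: q_def)
  have "(\<lambda>t. y (t + L)) = y"
  proof (rule second_order_solution_unique[where g = "\<lambda>_ x. - f x" and L = M and q = q])
    show "((\<lambda>t. y (t + L)) has_vector_derivative (v (t + L) + \<epsilon> * c) + q t) (at t)" for t
      using has_vector_derivative_shift[OF y(1)[of "t + L"]] q[of t] by (simp add: q_def algebra_simps)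
    show "((\<lambda>t. v (t + L) + \<epsilon> * c) has_vector_derivative - f (y (t + L))) (at t)" for t
      using has_vector_derivative_add[OF has_vector_derivative_shift[OF y(2)[of "t + L"]]
          has_vector_derivative_const[of "\<epsilon> * c"]] by simp
    show "(y has_vector_derivative v t + q t) (at t)" for t
      using y(1) by (simp add: q_def)
    show "v (0 + L) + \<epsilon> * c = v 0"
      using return(2)[folded q_def] q[of 0] q0 by simp
    show "norm (- f a - - f b) \<le> M * norm (a - b)" for a b
      using lip(1)[of a b] by (simp add: abs_minus_commute)
  qed (use return lip y in auto)
  then show ?thesis by (rule fun_cong)
qed

lemma dist_vector_Re_Im:
  "dist (vector [Re a, Im a] :: real^2) (vector [Re b, Im b]) = dist a b"
  by (simp add: dist_norm norm_eq_sqrt_inner inner_vec_def sum_2 cmod_def power2_eq_square inner_complex_def)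

lemma vector_Re_Im_eq_0_iff: "(vector [Re a, Im a] :: real^2) = 0 \<longleftrightarrow> a = 0"
  by (auto simp: vec_eq_iff forall_2 complex_eq_iff)

lemma indefinite_integral_quasiperiodic:
  fixes p P :: "real \<Rightarrow> real"
  assumes P: "\<And>s t. s \<le> t \<Longrightarrow> P t - P s = integral {s..t} p"
    and p: "\<And>t. p (t + L) = p t"
  shows "P (t + L) = P t + (P L - P 0)"
proof -
  have D: "P (t + L) - P t = P (s + L) - P s" if "s \<le> t" for s t
  proof -
    have "P (t + L) - P (s + L) = integral {s + L..t + L} p" using P that by simp
    also have "\<dots> = integral {s..t} (\<lambda>x. p (x + L))"
      using integral_shift_real_ivl[of "s + L" L "t + L" p] by simp
    also have "\<dots> = P t - P s" using P[OF that] by (simp add: p)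
    finally show ?thesis by simp
  qed
  show ?thesis using D[of 0 t] D[of t 0] by (cases "0 \<le> t") auto
qed

theorem proposition2p2:
  fixes V V' V'' p :: "real \<Rightarrow> real" and \<theta>s rs :: real
  assumes "\<And>x. (V has_real_derivative V' x) (at x)"
    and "\<And>x. (V' has_real_derivative V'' x) (at x)"
    and "continuous_on UNIV V''"
    and "V 0 = 0"
    and "\<And>x. x \<noteq> 0 \<Longrightarrow> x * V' x > 0"
    and "\<And>a b x. solves_ode2 (\<lambda>_ y. - V' y) a b x \<Longrightarrow> periodic_2pi x"
    and "bounded (range V'')"
    and "L1_torus p"
    and "rs > 0"
    and "nondegenerate_zero (Phi V' V'' p) \<theta>s rs"
  shows "\<exists>\<epsilon>0>0. \<forall>\<epsilon>. \<bar>\<epsilon>\<bar> < \<epsilon>0 \<longrightarrow>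
           (\<exists>x. caratheodory_solution2 (\<lambda>t y. \<epsilon> * p t - V' y) x \<and> periodic_2pi x)"
proof -
  define T where "T = 2 * pi"
  have T: "T > 0" by (simp add: T_def)
  obtain M where M: "M \<ge> 0" "\<And>x. \<bar>V'' x\<bar> \<le> M"
  proof -
    from assms(7) obtain M where "\<And>x. \<bar>V'' x\<bar> \<le> M" unfolding bounded_iff by auto
    moreover from this[of 0] have "M \<ge> 0" by linarith
    ultimately show thesis using that by blast
  qed
  have lipV: "\<bar>V' a - V' b\<bar> \<le> M * \<bar>a - b\<bar>" for a b
    by (rule derivative_bounded_imp_lipschitz[OF assms(2) M(2)])
  have contV': "continuous_on UNIV V'"
    using assms(2) DERIV_isCont continuous_at_imp_continuous_on by blast
  have lipV'': "norm (- (V'' s *\<^sub>R x) - - (V'' s *\<^sub>R y)) \<le> M * norm (x - y)" for s and x y :: complex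
  proof -
    have "norm (- (V'' s *\<^sub>R x) - - (V'' s *\<^sub>R y)) = \<bar>V'' s\<bar> * norm (x - y)"
      by (simp add: norm_minus_commute flip: scaleR_diff_right)
    then show ?thesis using M(2)[of s] by (simp add: mult_right_mono)
  qed

  define \<phi> where "\<phi> r t = free_solution V' t r" for r t
  have sol\<phi>: "solves_ode2 (\<lambda>_ y. - V' y) r 0 (\<phi> r)" for r
  proof -
    have "\<exists>!x. solves_ode2 (\<lambda>_ y. - V' y) r 0 x"
    proof (rule solves_ode2_ex1[where L = M and C = "\<bar>V' 0\<bar>"])
      have "continuous_on UNIV (\<lambda>q :: real \<times> real. - V' (snd q))"
        by (intro continuous_intros continuous_on_compose2[OF contV']) auto
      then show "continuous_on UNIV (\<lambda>(t :: real, x). - V' x)" by (simp add: case_prod_unfold)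
      show "norm (- V' 0) \<le> \<bar>V' 0\<bar> * exp \<bar>t\<bar>" for t :: real
        by (simp add: mult_le_cancel_left1)
    qed (use lipV M in \<open>auto simp: abs_minus_commute\<close>)
    then show ?thesis
      unfolding \<phi>_def free_solution_def by (rule theI')
  qed
  then have "\<forall>r. \<exists>v. v 0 = 0 \<and> (\<forall>t. (\<phi> r has_vector_derivative v t) (at t) \<and>
      (v has_vector_derivative - V' (\<phi> r t)) (at t))" and \<phi>0: "\<And>r. \<phi> r 0 = r"
    unfolding solves_ode2_def by blast+
  from choice[OF this(1)] obtain w where w0: "\<And>r. w r 0 = 0"
    and d\<phi>: "\<And>r t. (\<phi> r has_vector_derivative w r t) (at t)"
    and dw: "\<And>r t. (w r has_vector_derivative - V' (\<phi> r t)) (at t)"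
    by blast
  have per\<phi>: "\<phi> r (t + T) = \<phi> r t" for r t
    using assms(6)[OF sol\<phi>] by (simp add: periodic_2pi_def T_def)
  have \<phi>T: "\<phi> r T = r" for r using per\<phi>[of r 0] \<phi>0 by simp
  have wT: "w r T = 0" for r
  proof -
    have "(\<phi> r has_vector_derivative w r T) (at 0)"
      using has_vector_derivative_shift[of "\<phi> r" "w r T" 0 T] d\<phi>[of r T] by (simp add: per\<phi>)
    then show ?thesis using vector_derivative_unique_at[OF _ d\<phi>[of r 0]] w0 by simp
  qed
  have cont\<phi>: "continuous_on (UNIV \<times> {0..S}) (\<lambda>(r, t). \<phi> r t)"
    and contw: "continuous_on (UNIV \<times> {0..S}) (\<lambda>(r, t). w r t)" for S
  proof -
    have "continuous_on (UNIV \<times> {0..S} \<times> UNIV) (\<lambda>q :: real \<times> real \<times> real. - V' (snd (snd q)))"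
      by (intro continuous_intros continuous_on_compose2[OF contV']) auto
    then have c: "continuous_on (UNIV \<times> {0..S} \<times> UNIV) (\<lambda>(l :: real, t :: real, x). - V' x)"
      by (simp add: case_prod_unfold)
    have z: "continuous_on UNIV (\<lambda>(l :: real, t :: real). 0 :: real)"
      by (simp add: case_prod_unfold)
    have l: "norm (- V' x - - V' y) \<le> M * norm (x - y)" for x y
      using lipV[of x y] by (simp add: abs_minus_commute)
    note dep = second_order_continuous_dependence[OF c z l M(1), where x = \<phi> and v = w]
    show "continuous_on (UNIV \<times> {0..S}) (\<lambda>(r, t). \<phi> r t)"
      by (rule dep(1)) (simp_all add: d\<phi> dw \<phi>0 w0)
    show "continuous_on (UNIV \<times> {0..S}) (\<lambda>(r, t). w r t)"
      by (rule dep(2)) (simp_all add: d\<phi> dw \<phi>0 w0)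
  qed
  have cont\<phi>t: "continuous_on UNIV (\<phi> r)" for r
    using d\<phi> by (meson continuous_at_imp_continuous_on has_vector_derivative_continuous)

  define \<psi> where "\<psi> r t = variational_solution V' V'' t r" for r t
  have "solves_ode2 (\<lambda>s z. - (V'' (\<phi> r s) *\<^sub>R z)) 1 \<i> (\<psi> r)" for r
  proof -
    have "\<exists>!x. solves_ode2 (\<lambda>s z. - (V'' (\<phi> r s) *\<^sub>R z)) (1::complex) \<i> x"
    proof (rule solves_ode2_ex1[where L = M and C = 0])
      have "continuous_on UNIV (\<lambda>q :: real \<times> complex. - (V'' (\<phi> r (fst q)) *\<^sub>R snd q))"
        by (intro continuous_intros continuous_on_compose2[OF assms(3)]
            continuous_on_compose2[OF cont\<phi>t]) auto
      then show "continuous_on UNIV (\<lambda>(t, x :: complex). - (V'' (\<phi> r t) *\<^sub>R x))"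
        by (simp add: case_prod_unfold)
    qed (use lipV'' M in auto)
    then show ?thesis
      unfolding \<psi>_def variational_solution_def \<phi>_def scaleR_conv_of_real by (rule theI')
  qed
  then have "\<forall>r. \<exists>v. v 0 = \<i> \<and> (\<forall>t. (\<psi> r has_vector_derivative v t) (at t) \<and>
      (v has_vector_derivative - (V'' (\<phi> r t) *\<^sub>R \<psi> r t)) (at t))" and \<psi>0: "\<And>r. \<psi> r 0 = 1"
    unfolding solves_ode2_def by blast+
  from choice[OF this(1)] obtain \<xi> where \<xi>0: "\<And>r. \<xi> r 0 = \<i>"
    and d\<psi>: "\<And>r t. (\<psi> r has_vector_derivative \<xi> r t) (at t)"
    and d\<xi>: "\<And>r t. (\<xi> r has_vector_derivative - (V'' (\<phi> r t) *\<^sub>R \<psi> r t)) (at t)"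
    by blast
  have cont\<psi>: "continuous_on (UNIV \<times> {0..S}) (\<lambda>(r, t). \<psi> r t)"
    and cont\<xi>: "continuous_on (UNIV \<times> {0..S}) (\<lambda>(r, t). \<xi> r t)" for S
  proof -
    have "continuous_on (UNIV \<times> {0..S} \<times> UNIV)
        (\<lambda>q :: real \<times> real \<times> complex. (\<lambda>(r, t). \<phi> r t) (fst q, fst (snd q)))"
      by (rule continuous_on_compose2[OF cont\<phi>[of S]]) (auto intro!: continuous_intros)
    then have "continuous_on (UNIV \<times> {0..S} \<times> UNIV)
        (\<lambda>q :: real \<times> real \<times> complex. - (V'' (\<phi> (fst q) (fst (snd q))) *\<^sub>R snd (snd q)))"
      by (intro continuous_intros continuous_on_compose2[OF assms(3)]) auto
    then have c: "continuous_on (UNIV \<times> {0..S} \<times> UNIV) (\<lambda>(r, t, x :: complex). - (V'' (\<phi> r t) *\<^sub>R x))"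
      by (simp add: case_prod_unfold)
    have z: "continuous_on UNIV (\<lambda>(l :: real, t :: real). 0 :: complex)"
      by (simp add: case_prod_unfold)
    note dep = second_order_continuous_dependence[OF c z lipV'' M(1), where x = \<psi> and v = \<xi>]
    show "continuous_on (UNIV \<times> {0..S}) (\<lambda>(r, t). \<psi> r t)"
      by (rule dep(1)) (simp_all add: d\<psi> d\<xi> \<psi>0 \<xi>0)
    show "continuous_on (UNIV \<times> {0..S}) (\<lambda>(r, t). \<xi> r t)"
      by (rule dep(2)) (simp_all add: d\<psi> d\<xi> \<psi>0 \<xi>0)
  qed

  have absp: "p absolutely_integrable_on {a..b}" and perp: "p (t + T) = p t" for a b t
    using assms(8) by (auto simp: L1_torus_def periodic_2pi_def T_def)
  obtain P where contP: "continuous_on UNIV P"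
    and P: "\<And>s t. s \<le> t \<Longrightarrow> P t - P s = integral {s..t} p"
    using indefinite_integral_exists[of p] absp set_lebesgue_integral_eq_integral(1) by blast
  note shiftP = indefinite_integral_quasiperiodic[of P p T, OF P perp]
  define Q where "Q \<theta> t = P (t - \<theta>) - P (- \<theta>)" for \<theta> t
  have contQ: "continuous_on UNIV (\<lambda>(l :: real^2, t). Q (l $ 1) t)"
  proof -
    have "continuous_on UNIV (\<lambda>q :: (real^2) \<times> real. Q (fst q $ 1) (snd q))"
      unfolding Q_def by (intro continuous_intros continuous_on_compose2[OF contP]) auto
    then show ?thesis by (simp add: case_prod_unfold)
  qed
  have contQt: "continuous_on UNIV (Q \<theta>)" for \<theta>
    unfolding Q_def by (intro continuous_intros continuous_on_compose2[OF contP]) auto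
  have growthQ: "\<exists>C. \<forall>t. \<bar>Q \<theta> t\<bar> \<le> C * exp \<bar>t\<bar>" for \<theta>
  proof (rule quasiperiodic_exp_growth[OF contQt T])
    show "Q \<theta> (t + T) = Q \<theta> t + (P T - P 0)" for t
      using shiftP[of "t - \<theta>"] by (simp add: Q_def algebra_simps)
  qed

  have Phi_eq: "Phi V' V'' p \<theta> r = (1 / T) *\<^sub>R
    (Q \<theta> T *\<^sub>R \<psi> r T - integral {0..T} (\<lambda>t. Q \<theta> t *\<^sub>R \<xi> r t))" for \<theta> r
  proof -
    have shift: "(\<lambda>t. k (t - \<theta>)) integrable_on {a..b}" if "\<And>a b. k integrable_on {a..b}"
      for a b and k :: "real \<Rightarrow> real"
      using integrable_shift_real_ivl[OF that[of "a - \<theta>" "b - \<theta>"], of "- \<theta>"] by simp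
    have Q0: "Q \<theta> 0 = 0" by (simp add: Q_def)
    have abs: "(\<lambda>t. p (t - \<theta>)) absolutely_integrable_on {a..b}" for a b
      using absp shift[of p] shift[of "\<lambda>t. norm (p t)"] unfolding absolutely_integrable_on_def by blast
    have incr: "Q \<theta> t - Q \<theta> s = integral {s..t} (\<lambda>t. p (t - \<theta>))" if "s \<le> t" for s t
      using P[of "s - \<theta>" "t - \<theta>"] that integral_shift_real_ivl[of "s - \<theta>" "- \<theta>" "t - \<theta>" p]
      by (simp add: Q_def)
    have cont\<xi>t: "continuous_on UNIV (\<xi> r)"
      using d\<xi> by (meson continuous_at_imp_continuous_on has_vector_derivative_continuous)
    note parts = integral_by_parts_indefinite_integral[OF abs incr contQt d\<psi> cont\<xi>t less_imp_le[OF T]]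
    have "(LINT t:{0..2 * pi}|lebesgue. of_real (p (t - \<theta>)) * variational_solution V' V'' t r)
        = integral {0..T} (\<lambda>t. p (t - \<theta>) *\<^sub>R \<psi> r t)"
      using set_lebesgue_integral_eq_integral(2)[OF parts(1)]
      by (simp add: T_def \<psi>_def scaleR_conv_of_real)
    also have "\<dots> = Q \<theta> T *\<^sub>R \<psi> r T - integral {0..T} (\<lambda>t. Q \<theta> t *\<^sub>R \<xi> r t)"
      using parts(2) Q0 by simp
    finally show ?thesis
      unfolding Phi_def by (simp add: T_def scaleR_conv_of_real[of "1 / (2 * pi)"])
  qed

  have "\<forall>e :: real \<times> (real^2). \<exists>yv :: (real \<Rightarrow> real) \<times> (real \<Rightarrow> real).
      fst yv 0 = snd e $ 2 \<and> snd yv 0 = 0 \<and>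
      (\<forall>t. (fst yv has_vector_derivative snd yv t + fst e * Q (snd e $ 1) t) (at t) \<and>
        (snd yv has_vector_derivative - V' (fst yv t)) (at t))"
  proof
    fix e :: "real \<times> (real^2)"
    define \<epsilon> \<theta> where "\<epsilon> = fst e" and "\<theta> = snd e $ 1"
    obtain C where C: "\<And>t. \<bar>Q \<theta> t\<bar> \<le> C * exp \<bar>t\<bar>" using growthQ by blast
    define D where "D = \<bar>V' 0\<bar> + \<bar>\<epsilon>\<bar> * C"
    have C0: "C \<ge> 0" using order_trans[OF abs_ge_zero C[of 0]] by simp
    have "\<exists>y v. y 0 = snd e $ 2 \<and> v 0 = 0 \<and> (\<forall>t. (y has_vector_derivative v t + \<epsilon> * Q \<theta> t) (at t) \<and>
        (v has_vector_derivative - V' (y t)) (at t))"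
    proof (rule second_order_solution_exists[where L = M and C = D])
      have "continuous_on UNIV (\<lambda>q :: real \<times> real. - V' (snd q))"
        by (intro continuous_intros continuous_on_compose2[OF contV']) auto
      then show "continuous_on UNIV (\<lambda>(t :: real, x). - V' x)" by (simp add: case_prod_unfold)
      show "continuous_on UNIV (\<lambda>t. \<epsilon> * Q \<theta> t)" by (intro continuous_intros contQt)
      have D: "D * exp \<bar>t\<bar> = \<bar>V' 0\<bar> * exp \<bar>t\<bar> + \<bar>\<epsilon>\<bar> * (C * exp \<bar>t\<bar>)" for t
        by (simp add: D_def algebra_simps)
      have "\<bar>V' 0\<bar> \<le> \<bar>V' 0\<bar> * exp \<bar>t\<bar>" "0 \<le> \<bar>\<epsilon>\<bar> * (C * exp \<bar>t\<bar>)" for t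
        using C0 by (simp_all add: mult_le_cancel_left1)
      then show "norm (- V' 0) \<le> D * exp \<bar>t\<bar>" for t
        unfolding D by (simp add: add_increasing2)
      have "\<bar>\<epsilon> * Q \<theta> t\<bar> \<le> \<bar>\<epsilon>\<bar> * (C * exp \<bar>t\<bar>)" for t
        unfolding abs_mult by (rule mult_left_mono[OF C]) simp
      then show "norm (\<epsilon> * Q \<theta> t) \<le> D * exp \<bar>t\<bar>" for t
        unfolding D by (simp add: add_increasing)
    qed (use lipV M in \<open>auto simp: abs_minus_commute\<close>)
    then show "\<exists>yv :: (real \<Rightarrow> real) \<times> (real \<Rightarrow> real).
      fst yv 0 = snd e $ 2 \<and> snd yv 0 = 0 \<and>
      (\<forall>t. (fst yv has_vector_derivative snd yv t + fst e * Q (snd e $ 1) t) (at t) \<and>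
        (snd yv has_vector_derivative - V' (fst yv t)) (at t))"
      by (auto simp: \<epsilon>_def \<theta>_def)
  qed
  from choice[OF this] obtain G :: "real \<times> (real^2) \<Rightarrow> (real \<Rightarrow> real) \<times> (real \<Rightarrow> real)"
    where G: "\<And>e. fst (G e) 0 = snd e $ 2" "\<And>e. snd (G e) 0 = 0"
      "\<And>e t. (fst (G e) has_vector_derivative snd (G e) t + fst e * Q (snd e $ 1) t) (at t)"
      "\<And>e t. (snd (G e) has_vector_derivative - V' (fst (G e) t)) (at t)"
    by blast
  define Y Z where "Y \<epsilon> l = fst (G (\<epsilon>, l))" and "Z \<epsilon> l = snd (G (\<epsilon>, l))" for \<epsilon> l
  have Y0: "Y \<epsilon> l 0 = l $ 2" and Z0: "Z \<epsilon> l 0 = 0"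
    and dY: "(Y \<epsilon> l has_vector_derivative Z \<epsilon> l t + \<epsilon> * Q (l $ 1) t) (at t)"
    and dZ: "(Z \<epsilon> l has_vector_derivative - V' (Y \<epsilon> l t)) (at t)" for \<epsilon> l t
    using G[of "(\<epsilon>, l)"] by (simp_all add: Y_def Z_def)
  have contY: "continuous_on UNIV (\<lambda>l. Y \<epsilon> l T)" and contZ: "continuous_on UNIV (\<lambda>l. Z \<epsilon> l T)" for \<epsilon>
  proof -
    have "continuous_on (UNIV \<times> {0..T} \<times> UNIV) (\<lambda>q :: (real^2) \<times> real \<times> real. - V' (snd (snd q)))"
      by (intro continuous_intros continuous_on_compose2[OF contV']) auto
    then have c: "continuous_on (UNIV \<times> {0..T} \<times> UNIV) (\<lambda>(l :: real^2, t :: real, x). - V' x)"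
      by (simp add: case_prod_unfold)
    have z: "continuous_on UNIV (\<lambda>(l :: real^2, t). \<epsilon> * Q (l $ 1) t)"
      using continuous_on_mult_left[OF contQ, of \<epsilon>] by (simp add: case_prod_unfold)
    have l: "norm (- V' x - - V' y) \<le> M * norm (x - y)" for x y
      using lipV[of x y] by (simp add: abs_minus_commute)
    note dep = second_order_continuous_dependence[OF c z l M(1), where x = "Y \<epsilon>" and v = "Z \<epsilon>"]
    have sec: "continuous_on UNIV (\<lambda>l :: real^2. (l, T))" "range (\<lambda>l :: real^2. (l, T)) \<subseteq> UNIV \<times> {0..T}"
      using T by (auto intro!: continuous_intros)
    have "continuous_on (UNIV \<times> {0..T}) (\<lambda>(l, t). Y \<epsilon> l t)"
      by (rule dep(1)) (simp_all add: dY dZ Y0 Z0 continuous_intros)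
    from continuous_on_compose2[OF this sec] show "continuous_on UNIV (\<lambda>l. Y \<epsilon> l T)"
      by simp
    have "continuous_on (UNIV \<times> {0..T}) (\<lambda>(l, t). Z \<epsilon> l t)"
      by (rule dep(2)) (simp_all add: dY dZ Y0 Z0 continuous_intros)
    from continuous_on_compose2[OF this sec] show "continuous_on UNIV (\<lambda>l. Z \<epsilon> l T)"
      by simp
  qed

  define W where "W \<epsilon> l = (Z \<epsilon> l T + \<epsilon> * Q (l $ 1) T - w (l $ 2) T) *\<^sub>R \<psi> (l $ 2) T
      - (Y \<epsilon> l T - \<phi> (l $ 2) T) *\<^sub>R \<xi> (l $ 2) T" for \<epsilon> and l :: "real^2"
  have contW: "continuous_on UNIV (W \<epsilon>)" for \<epsilon>
  proof -
    have sec: "continuous_on UNIV (\<lambda>l :: real^2. (l $ 2, T))" "range (\<lambda>l :: real^2. (l $ 2, T)) \<subseteq> UNIV \<times> {0..T}"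
      using T by (auto intro!: continuous_intros)
    have r: "continuous_on UNIV (\<lambda>l :: real^2. h (l $ 2) T)"
      if h: "continuous_on (UNIV \<times> {0..T}) (\<lambda>(r, t). h r t)" for h :: "real \<Rightarrow> real \<Rightarrow> complex"
      using continuous_on_compose2[OF h sec] by simp
    have "continuous_on UNIV (\<lambda>l :: real^2. Q (l $ 1) T)"
      unfolding Q_def by (intro continuous_intros continuous_on_compose2[OF contP]) auto
    then show ?thesis
      unfolding W_def \<phi>T wT
      by (intro continuous_intros contY contZ r[OF cont\<psi>] r[OF cont\<xi>])
  qed

  obtain U :: "(real^2) set" where "bounded U" "vector [\<theta>s, rs] \<in> U"
    and deg: "brouwer_degree (plane_map (Phi V' V'' p)) U 0 \<noteq> 0"
    using assms(10) unfolding nondegenerate_zero_def by blast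
  define K where "K = closure U"
  have cK: "compact K" using \<open>bounded U\<close> by (simp add: K_def)
  define f where "f = plane_map (Phi V' V'' p)"
  define \<delta> where "\<delta> = infdist 0 (f ` frontier U)"
  have "\<delta> > 0"
  proof -
    have contf: "continuous_on (closure U) f" and "0 \<notin> f ` frontier U"
      using deg unfolding brouwer_degree_def f_def Let_def by (auto split: if_splits)
    moreover have "frontier U \<noteq> {}"
      using \<open>vector [\<theta>s, rs] \<in> U\<close> \<open>bounded U\<close> not_bounded_UNIV by (auto simp: frontier_eq_empty)
    moreover have "closed (f ` frontier U)"
      using \<open>bounded U\<close> contf
      by (intro compact_imp_closed compact_continuous_image compact_frontier_bounded)
        (auto simp: frontier_def elim: continuous_on_subset)
    ultimately show ?thesis
      unfolding \<delta>_def by (intro infdist_pos_not_in_closed) auto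
  qed

  have cKT: "compact (K \<times> {0..T})" using cK by (intro compact_Times) auto
  have bdd: "\<exists>B>0. \<forall>l\<in>K. \<forall>t\<in>{0..T}. norm (h l t) \<le> B"
    if "continuous_on (K \<times> {0..T}) (\<lambda>q. h (fst q) (snd q))"
    for h :: "real^2 \<Rightarrow> real \<Rightarrow> 'b::real_normed_vector"
  proof -
    have "bounded ((\<lambda>q. h (fst q) (snd q)) ` (K \<times> {0..T}))"
      by (intro compact_imp_bounded compact_continuous_image that cKT)
    then show ?thesis unfolding bounded_pos by force
  qed
  have sec: "continuous_on (K \<times> {0..T}) (\<lambda>q. (fst q $ 2, snd q))"
    "(\<lambda>q. (fst q $ 2, snd q)) ` (K \<times> {0..T}) \<subseteq> UNIV \<times> {0..T}"
    by (auto intro!: continuous_intros)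
  obtain B\<phi> where B\<phi>: "B\<phi> > 0" "\<And>l t. l \<in> K \<Longrightarrow> t \<in> {0..T} \<Longrightarrow> \<bar>\<phi> (l $ 2) t\<bar> \<le> B\<phi>"
  proof -
    have "continuous_on (K \<times> {0..T}) (\<lambda>q. \<phi> (fst q $ 2) (snd q))"
      using continuous_on_compose2[OF cont\<phi>[of T] sec] by simp
    from bdd[OF this] that show thesis by auto
  qed
  obtain B\<psi> where B\<psi>: "B\<psi> > 0" "\<And>l t. l \<in> K \<Longrightarrow> t \<in> {0..T} \<Longrightarrow> norm (\<psi> (l $ 2) t) \<le> B\<psi>"
  proof -
    have "continuous_on (K \<times> {0..T}) (\<lambda>q. \<psi> (fst q $ 2) (snd q))"
      using continuous_on_compose2[OF cont\<psi>[of T] sec] by simp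
    from bdd[OF this] that show thesis by auto
  qed
  obtain BQ where BQ: "BQ > 0" "\<And>l t. l \<in> K \<Longrightarrow> t \<in> {0..T} \<Longrightarrow> \<bar>Q (l $ 1) t\<bar> \<le> BQ"
  proof -
    have "continuous_on (K \<times> {0..T}) (\<lambda>q. Q (fst q $ 1) (snd q))"
      using continuous_on_subset[OF contQ, of "K \<times> {0..T}"] by (simp add: case_prod_unfold)
    from bdd[OF this] that show thesis by auto
  qed
  define E where "E = 2 * BQ * T * exp (2 * (1 + M) * T)"
  have E: "E > 0" using BQ(1) T by (simp add: E_def)
  define \<kappa> where "\<kappa> = \<delta> / (2 * B\<psi> * E)"
  have \<kappa>: "\<kappa> > 0" using \<open>\<delta> > 0\<close> B\<psi>(1) E by (simp add: \<kappa>_def)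
  have "uniformly_continuous_on {- (B\<phi> + 1)..B\<phi> + 1} V''"
    by (intro compact_uniformly_continuous continuous_on_subset[OF assms(3)]) auto
  then obtain \<rho>0 where \<rho>0: "\<rho>0 > 0" "\<And>a b. a \<in> {- (B\<phi> + 1)..B\<phi> + 1} \<Longrightarrow> b \<in> {- (B\<phi> + 1)..B\<phi> + 1} \<Longrightarrow>
      dist b a < \<rho>0 \<Longrightarrow> dist (V'' b) (V'' a) < \<kappa>"
    unfolding uniformly_continuous_on_def using \<kappa> by blast
  define \<rho> where "\<rho> = min \<rho>0 1"
  have \<rho>: "\<rho> > 0" using \<rho>0(1) by (simp add: \<rho>_def)
  define \<epsilon>0 where "\<epsilon>0 = \<rho> / E"
  have "\<epsilon>0 > 0" using \<rho> E by (simp add: \<epsilon>0_def)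

  have close: "norm ((1 / (T * \<epsilon>)) *\<^sub>R W \<epsilon> l - Phi V' V'' p (l $ 1) (l $ 2)) < \<delta>"
    if \<epsilon>: "\<epsilon> \<noteq> 0" "\<bar>\<epsilon>\<bar> < \<epsilon>0" and l: "l \<in> K" for \<epsilon> l
  proof -
    define \<theta> r where "\<theta> = l $ 1" and "r = l $ 2"
    have d: "\<bar>Y \<epsilon> l t - \<phi> r t\<bar> \<le> E * \<bar>\<epsilon>\<bar>" if "0 \<le> t" "t \<le> T" for t
      unfolding E_def
      by (rule forced_solution_dist_le[where f = V' and w = "w r" and v = "Z \<epsilon> l" and q = "Q \<theta>"])
        (use that BQ(2)[OF l] in \<open>auto simp: \<theta>_def r_def d\<phi> dw dY dZ Y0 Z0 \<phi>0 w0 lipV M\<close>)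
    have E\<epsilon>: "E * \<bar>\<epsilon>\<bar> < \<rho>"
      using \<epsilon>(2) E by (simp add: \<epsilon>0_def pos_less_divide_eq mult.commute)
    have small: "\<bar>V'' (\<phi> r t) * (Y \<epsilon> l t - \<phi> r t) - (V' (Y \<epsilon> l t) - V' (\<phi> r t))\<bar> * norm (\<psi> r t)
        \<le> \<kappa> * (E * \<bar>\<epsilon>\<bar>) * B\<psi>" if t: "0 < t" "t < T" for t
    proof -
      have dt: "\<bar>Y \<epsilon> l t - \<phi> r t\<bar> \<le> E * \<bar>\<epsilon>\<bar>" using d t by simp
      have \<phi>t: "\<bar>\<phi> r t\<bar> \<le> B\<phi>" using B\<phi>(2)[OF l] t by (simp add: r_def)
      have "\<bar>V'' x - V'' (\<phi> r t)\<bar> \<le> \<kappa>" if "\<bar>x - \<phi> r t\<bar> \<le> \<bar>Y \<epsilon> l t - \<phi> r t\<bar>" for x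
      proof -
        have "\<bar>x - \<phi> r t\<bar> < \<rho>" using that dt E\<epsilon> by linarith
        then have "\<bar>x - \<phi> r t\<bar> < \<rho>0" "\<bar>x - \<phi> r t\<bar> < 1" by (simp_all add: \<rho>_def)
        moreover have "\<phi> r t \<in> {- (B\<phi> + 1)..B\<phi> + 1}" "x \<in> {- (B\<phi> + 1)..B\<phi> + 1}"
          using \<phi>t calculation(2) unfolding atLeastAtMost_iff by linarith+
        ultimately show ?thesis
          using \<rho>0(2)[of "\<phi> r t" x] by (simp add: dist_real_def)
      qed
      from linearization_error_le[OF assms(2) this]
      have "\<bar>V'' (\<phi> r t) * (Y \<epsilon> l t - \<phi> r t) - (V' (Y \<epsilon> l t) - V' (\<phi> r t))\<bar> \<le> \<kappa> * \<bar>Y \<epsilon> l t - \<phi> r t\<bar>" .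
      also have "\<dots> \<le> \<kappa> * (E * \<bar>\<epsilon>\<bar>)" using dt \<kappa> by (intro mult_left_mono) auto
      finally show ?thesis
        using B\<psi>(2)[OF l, of t] t \<kappa> E by (intro mult_mono) (auto simp: r_def)
    qed
    have wb: "norm (W \<epsilon> l - \<epsilon> *\<^sub>R (Q \<theta> T *\<^sub>R \<psi> r T - integral {0..T} (\<lambda>t. Q \<theta> t *\<^sub>R \<xi> r t)))
        \<le> T * (\<kappa> * (E * \<bar>\<epsilon>\<bar>) * B\<psi>)"
      unfolding W_def \<theta>_def[symmetric] r_def[symmetric]
      by (rule lagrange_identity_remainder[where f = V' and f' = V'' and q = "Q \<theta>"])
        (use small T in \<open>auto simp: \<theta>_def r_def d\<phi> dw dY dZ Y0 Z0 \<phi>0 w0 d\<psi> d\<xi> contQt\<close>)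
    have eq: "(1 / (T * \<epsilon>)) *\<^sub>R W \<epsilon> l - Phi V' V'' p \<theta> r = (1 / (T * \<epsilon>)) *\<^sub>R
      (W \<epsilon> l - \<epsilon> *\<^sub>R (Q \<theta> T *\<^sub>R \<psi> r T - integral {0..T} (\<lambda>t. Q \<theta> t *\<^sub>R \<xi> r t)))"
      using \<epsilon>(1) unfolding Phi_eq scaleR_diff_right[of "1 / (T * \<epsilon>)"] by simp
    have coeff: "\<bar>1 / (T * \<epsilon>)\<bar> = 1 / (T * \<bar>\<epsilon>\<bar>)"
      using T by (simp add: abs_mult)
    have "norm ((1 / (T * \<epsilon>)) *\<^sub>R W \<epsilon> l - Phi V' V'' p \<theta> r)
        \<le> (1 / (T * \<bar>\<epsilon>\<bar>)) * (T * (\<kappa> * (E * \<bar>\<epsilon>\<bar>) * B\<psi>))"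
      unfolding eq norm_scaleR coeff by (rule mult_left_mono[OF wb]) (use T in simp)
    also have "\<dots> = \<delta> / 2"
      using T E B\<psi>(1) \<epsilon>(1) by (simp add: \<kappa>_def)
    also have "\<dots> < \<delta>" using \<open>\<delta> > 0\<close> by simp
    finally show ?thesis by (simp add: \<theta>_def r_def)
  qed

  have nonzero: "\<exists>x. caratheodory_solution2 (\<lambda>t y. \<epsilon> * p t - V' y) x \<and> periodic_2pi x"
    if \<epsilon>: "\<epsilon> \<noteq> 0" "\<bar>\<epsilon>\<bar> < \<epsilon>0" for \<epsilon>
  proof -
    define H where "H l = (1 / (T * \<epsilon>)) *\<^sub>R W \<epsilon> l" for l
    define h where "h l = (vector [Re (H l), Im (H l)] :: real^2)" for l
    have "\<exists>l\<in>closure U. h l = 0"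
    proof (rule brouwer_degree_nonzero_imp_solution[OF deg])
      have "continuous_on UNIV H" unfolding H_def by (intro continuous_intros contW)
      then have "continuous_on UNIV (\<lambda>l. if i = 1 then Re (H l) else Im (H l))" for i :: 2
        by (cases "i = 1") (auto intro: continuous_intros)
      then have "continuous_on UNIV (\<lambda>l. (\<chi> i. if i = 1 then Re (H l) else Im (H l)) :: real^2)"
        by (rule continuous_on_vec_lambda)
      moreover have "h = (\<lambda>l. \<chi> i. if i = 1 then Re (H l) else Im (H l))"
        by (auto simp: h_def vec_eq_iff forall_2)
      ultimately show "continuous_on (closure U) h" using continuous_on_subset by blast
      show "dist (h l) (plane_map (Phi V' V'' p) l) < infdist 0 (plane_map (Phi V' V'' p) ` frontier U)"
        if "l \<in> closure U" for l
        using close[OF \<epsilon>, of l] that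
        unfolding h_def plane_map_def[of _ l] dist_vector_Re_Im
        unfolding dist_norm H_def K_def \<delta>_def f_def by blast
    qed
    then obtain l where "h l = 0" by blast
    then have "H l = 0" unfolding h_def vector_Re_Im_eq_0_iff .
    then have "W \<epsilon> l = 0" using \<epsilon>(1) T by (simp add: H_def)
    define \<theta> r where "\<theta> = l $ 1" and "r = l $ 2"
    have "Z \<epsilon> l T + \<epsilon> * Q \<theta> T - w r T = 0" "Y \<epsilon> l T - \<phi> r T = 0"
      using scaleR_diff_eq_0_wronskian[OF variational_wronskian[OF d\<psi> d\<xi> \<psi>0 \<xi>0], of _ r T]
        \<open>W \<epsilon> l = 0\<close> unfolding W_def \<theta>_def r_def by blast+
    then have ret: "Y \<epsilon> l T = Y \<epsilon> l 0" "Z \<epsilon> l T + \<epsilon> * (P (T - \<theta>) - P (- \<theta>)) = Z \<epsilon> l 0"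
      by (simp_all add: wT \<phi>T Y0 Z0 r_def Q_def)
    note dY' = dY[of \<epsilon> l, folded \<theta>_def, unfolded Q_def]
    have "Y \<epsilon> l (t + T) = Y \<epsilon> l t" for t
      by (rule forced_solution_periodic[OF lipV M(1) shiftP dY' dZ ret])
    then have "periodic_2pi (\<lambda>t. Y \<epsilon> l (t + \<theta>))"
      unfolding periodic_2pi_def T_def[symmetric] by (metis add.commute add.left_commute)
    moreover have "caratheodory_solution2 (\<lambda>t y. \<epsilon> * p t - V' y) (\<lambda>t. Y \<epsilon> l (t + \<theta>))"
      by (rule caratheodory_solution2_of_system[OF contV' absp P dY' dZ])
    ultimately show ?thesis by blast
  qed
  have "caratheodory_solution2 (\<lambda>t y. 0 * p t - V' y) (\<lambda>t. \<phi> rs (t + 0))"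
    by (rule caratheodory_solution2_of_system[OF contV' absp P, where v = "w rs"])
      (simp_all add: d\<phi> dw)
  moreover have "periodic_2pi (\<phi> rs)"
    using per\<phi> by (simp add: periodic_2pi_def T_def)
  ultimately have "\<exists>x. caratheodory_solution2 (\<lambda>t y. 0 * p t - V' y) x \<and> periodic_2pi x"
    by auto
  with nonzero \<open>\<epsilon>0 > 0\<close> show ?thesis by metis
qed

end
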